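(* Let $M \geq 1$, let $\tau = (1,\dots,M)(M+1,\dots,2M) \in \mathfrak{S}_{2M}$ be a product of two disjoint $M$-cycles, and let $\sigma$ be uniformly distributed in $\mathfrak{S}_{2M}$. Then, as polynomials in $t$, $$\mathbb{E}\left( t^{\mathscr{C}([\sigma,\tau])} \right) = \frac{F_{2M+1}^+(t) - F_{2M+1}^-(t)}{(2M+1)!} + \frac{2}{(2M)!}\left( \frac{F_{M+1}^+(t) - F_{M+1}^-(t)}{M+1} \right)^2 - \frac{2}{(2M)!} \sum_{k=0}^{M} (-1)^k \frac{k!}{2M-k+1} \binom{M}{k}^2 \left( F_{2M-k+1}^+(t) + F_{2M-k+1}^+(-t) \right).$$
   Context: $\mathfrak{S}_n$ is the symmetric group on $\{1,\dots,n\}$. For a permutation $\pi$, $\mathscr{C}(\pi)$ denotes its number of cycles, fixed points being counted as cycles of length $1$ (for $M=1$, $\tau$ is the identity of $\mathfrak{S}_2$). The commutator is $[\sigma,\tau] = \sigma\tau\sigma^{-1}\tau^{-1}$. The rising and falling factorial polynomials are $F_n^+(X) = X(X+1)\cdots(X+n-1)$ and $F_n^-(X) = X(X-1)\cdots(X-n+1)$, with $F_0^+ = F_0^- = 1$. *)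

theory Defs
  imports
    "HOL-Probability.Probability_Mass_Function"
    "HOL-Computational_Algebra.Polynomial"
    "HOL-Combinatorics.Cycles"
    "HOL-Combinatorics.Orbits"
begin

text \<open>Permutations of the set \<open>{1..n}\<close> are functions on \<open>nat\<close> with \<open>\<pi> permutes {1..n}\<close>.
  The orbits of such a \<open>\<pi>\<close> on \<open>{1..n}\<close> are its cycles; a fixed point \<open>x\<close> has orbit \<open>{x}\<close>.\<close>

definition num_cycles :: "nat \<Rightarrow> (nat \<Rightarrow> nat) \<Rightarrow> nat" where
  "num_cycles n \<pi> = card (orbit \<pi> ` {1..n})"

definition commutator :: "('a \<Rightarrow> 'a) \<Rightarrow> ('a \<Rightarrow> 'a) \<Rightarrow> 'a \<Rightarrow> 'a" where
  "commutator \<sigma> \<tau> = \<sigma> \<circ> \<tau> \<circ> inv \<sigma> \<circ> inv \<tau>"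

definition two_cycles :: "nat \<Rightarrow> nat \<Rightarrow> nat" where
  "two_cycles M = cycle_of_list [1..<M + 1] \<circ> cycle_of_list [M + 1..<2 * M + 1]"

definition uniform_perm :: "nat \<Rightarrow> (nat \<Rightarrow> nat) pmf" where
  "uniform_perm n = pmf_of_set {\<sigma>. \<sigma> permutes {1..n}}"

text \<open>Rising and falling factorials of an element of an arbitrary commutative ring; at the
  indeterminate \<open>[:0, 1:]\<close> of a polynomial ring they are the factorial polynomials, and at
  \<open>- [:0, 1:]\<close> they are these polynomials with \<open>t\<close> replaced by \<open>- t\<close>.\<close>

abbreviation F_plus :: "nat \<Rightarrow> 'a :: comm_ring_1 \<Rightarrow> 'a" where
  "F_plus n X \<equiv> pochhammer X n"

definition F_minus :: "nat \<Rightarrow> 'a :: comm_ring_1 \<Rightarrow> 'a" where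
  "F_minus n X = (\<Prod>i<n. X - of_nat i)"

text \<open>Expectation of a polynomial-valued random variable on a finitely supported distribution.
  The type of polynomials is not a Banach space, so the Bochner integral is not available;
  the two lemmas below relate this to the library expectation, coefficientwise and pointwise.\<close>

definition poly_expectation :: "'a pmf \<Rightarrow> ('a \<Rightarrow> real poly) \<Rightarrow> real poly" where
  "poly_expectation p X = (\<Sum>x\<in>set_pmf p. smult (pmf p x) (X x))"

lemma coeff_poly_expectation:
  assumes "finite (set_pmf p)"
  shows "coeff (poly_expectation p X) k = measure_pmf.expectation p (\<lambda>x. coeff (X x) k)"
  using assms by (simp add: poly_expectation_def coeff_sum integral_measure_pmf_real mult.commute)

lemma poly_poly_expectation:
  assumes "finite (set_pmf p)"
  shows "poly (poly_expectation p X) t = measure_pmf.expectation p (\<lambda>x. poly (X x) t)"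
  using assms by (simp add: poly_expectation_def poly_sum integral_measure_pmf_real mult.commute)

end

theory Submission
  imports Defs
begin

text \<open>
  Both sides are polynomials, so it suffices to compare them at \<open>t = N\<close> for all natural numbers \<open>N\<close>.
  There \<open>N\<close> to the number of cycles of \<open>\<pi>\<close> is the number of colourings of the points with \<open>N\<close> colours
  that are constant on the cycles of \<open>\<pi>\<close>, and the task is to evaluate
  \<open>\<Sum>\<sigma>. N ^ cycles (\<sigma> \<circ> \<tau> \<circ> inv \<sigma> \<circ> \<rho>)\<close> for \<open>\<rho> = inv \<tau>\<close>; this sum is called \<open>conj_sum N A \<tau> \<rho>\<close>.

  The key is that, for arbitrary permutations \<open>\<tau>\<close> and \<open>\<rho>\<close> of a finite set, this sum equals
  \<open>\<langle>p\<^sub>\<tau> a, p\<^sub>\<rho> a\<rangle> / \<langle>a, a\<rangle>\<close>, where \<open>p\<^sub>\<tau>\<close> is the product of the power sums, in \<open>N\<close> variables, of the cycle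
  lengths of \<open>\<tau>\<close>, \<open>a\<close> is the Vandermonde determinant, and the Fischer product \<open>\<langle>\<cdot>, \<cdot>\<rangle>\<close> makes
  multiplication by a variable adjoint to differentiation (\<open>conj_sum_eq_psum_pairing\<close>). This replaces the
  character theory of the symmetric group. It holds because both sides have two properties.
  First, a fixed point of \<open>\<tau>\<close> can be removed at the price of removing a point of \<open>\<rho>\<close> in all possible
  ways: for the pairing, multiplication by the sum of the variables is adjoint to the sum of
  the partial derivatives, which annihilates \<open>a\<close> (\<open>conj_sum_fixpoint\<close>, \<open>psum_pairing_fixpoint\<close>).
  Second, a sum over all transpositions can be moved from \<open>\<tau>\<close> to \<open>\<rho>\<close>: for the sum over conjugates since
  it is central, for the pairing since it acts on \<open>p\<^sub>\<tau> a\<close>, up to a constant, as the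
  self-adjoint operator \<open>\<Sum>c<N. (x\<^sub>c * \<partial>\<^sub>c)\<^sup>2\<close> (\<open>conj_sum_transpositions\<close>, \<open>psum_pairing_transpositions\<close>). Starting from permutations
  with a fixed point, transpositions reach all others (\<open>vanish_by_transpositions\<close>).

  For two cycles of length \<open>M\<close>, multiplying \<open>a\<close> by the square of the \<open>M\<close>-th power sum raises two of the
  exponents \<open>0, \<dots>, N - 1\<close> by \<open>M\<close>, or one of them by \<open>2 * M\<close>. The surviving alternants are orthogonal
  with coefficients \<open>1\<close>, \<open>- 1\<close> and \<open>2\<close> (\<open>sum_raise_pairs\<close>), and their norms are products of rising
  factorials. A single exponent raised by \<open>2 * M\<close> yields the first term of the formula.
  The pairs of different exponents yield the square of a sum minus the sum of the squares, which
  are the second and the third term; all these sums telescope (\<open>sum_top_slots_pochhammer\<close>,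
  \<open>sum_top_slots_pochhammer_square\<close>).
\<close>

(* below, transpose is the transposition of two points, not that of a matrix *)
hide_const (open) Finite_Cartesian_Product.transpose

section \<open>Colourings constant on the cycles of a permutation\<close>

definition colorings :: "nat \<Rightarrow> 'a set \<Rightarrow> ('a \<Rightarrow> 'a) \<Rightarrow> ('a \<Rightarrow> nat) set" where
  "colorings N A \<pi> = {f \<in> A \<rightarrow>\<^sub>E {..<N}. \<forall>a\<in>A. f (\<pi> a) = f a}"

lemma finite_colorings [simp]: "finite A \<Longrightarrow> finite (colorings N A \<pi>)"
  unfolding colorings_def by (rule finite_subset[of _ "A \<rightarrow>\<^sub>E {..<N}"]) (auto intro: finite_PiE)

lemma colorings_cong:
  assumes "\<And>a. a \<in> A \<Longrightarrow> \<pi> a = \<pi>' a"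
  shows "colorings N A \<pi> = colorings N A \<pi>'"
  using assms by (auto simp: colorings_def)

lemma colorings_less: "f \<in> colorings N A \<pi> \<Longrightarrow> a \<in> A \<Longrightarrow> f a < N"
  by (auto simp: colorings_def)

lemma colorings_step: "f \<in> colorings N A \<pi> \<Longrightarrow> a \<in> A \<Longrightarrow> f (\<pi> a) = f a"
  by (auto simp: colorings_def)

lemma colorings_funpow:
  assumes "f \<in> colorings N A \<pi>" "\<pi> permutes A" "a \<in> A"
  shows "f ((\<pi> ^^ r) a) = f a"
proof (induction r)
  case (Suc r)
  have "(\<pi> ^^ r) a \<in> A"
    using assms permutes_in_image[OF permutes_funpow[OF assms(2)]] by blast
  then show ?case using Suc assms by (simp add: colorings_step)
qed auto

lemma colorings_inv:
  assumes "\<pi> permutes A"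
  shows "colorings N A (inv \<pi>) = colorings N A \<pi>"
proof -
  have 1: "\<pi> a \<in> A" "inv \<pi> a \<in> A" if "a \<in> A" for a
    using that assms permutes_inv[OF assms] by (simp_all add: permutes_in_image)
  have 2: "inv \<pi> (\<pi> a) = a" "\<pi> (inv \<pi> a) = a" for a
    using permutes_inverses[OF assms] by auto
  have "(\<forall>a\<in>A. f (inv \<pi> a) = f a) \<longleftrightarrow> (\<forall>a\<in>A. f (\<pi> a) = f a)" for f :: "'a \<Rightarrow> nat"
  proof (intro iffI ballI)
    fix a assume "a \<in> A" "\<forall>a\<in>A. f (inv \<pi> a) = f a"
    then show "f (\<pi> a) = f a" using 1(1)[of a] 2(1)[of a] by metis
  next
    fix a assume "a \<in> A" "\<forall>a\<in>A. f (\<pi> a) = f a"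
    then show "f (inv \<pi> a) = f a" using 1(2)[of a] 2(2)[of a] by metis
  qed
  then show ?thesis by (simp add: colorings_def)
qed

text \<open>A colouring that is constant on cycles is a function on the set of cycles. This is the only place
  where orbits are counted; from here on the number of cycles enters through colourings only.\<close>

lemma card_colorings:
  assumes "\<pi> permutes A" "finite A"
  shows "card (colorings N A \<pi>) = N ^ card (orbit \<pi> ` A)"
proof -
  let ?P = "orbit \<pi> ` A"
  have perm: "permutation \<pi>" using assms permutation_permutes by blast
  have self: "a \<in> orbit \<pi> a" for a using perm by (rule permutation_self_in_orbit)
  have const: "f b = f a" if f: "f \<in> colorings N A \<pi>" and a: "a \<in> A" and b: "b \<in> orbit \<pi> a" for f a b
  proof -
    obtain r where "b = (\<pi> ^^ r) a" using b orbit_altdef[of \<pi> a] by auto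
    then show ?thesis using colorings_funpow[OF f assms(1) a] by simp
  qed
  have "bij_betw (\<lambda>h. \<lambda>a\<in>A. h (orbit \<pi> a)) (?P \<rightarrow>\<^sub>E {..<N}) (colorings N A \<pi>)"
  proof (rule bij_betwI')
    fix h h' assume h: "h \<in> ?P \<rightarrow>\<^sub>E {..<N}" and h': "h' \<in> ?P \<rightarrow>\<^sub>E {..<N}"
    show "((\<lambda>a\<in>A. h (orbit \<pi> a)) = (\<lambda>a\<in>A. h' (orbit \<pi> a))) \<longleftrightarrow> h = h'"
    proof
      assume eq: "(\<lambda>a\<in>A. h (orbit \<pi> a)) = (\<lambda>a\<in>A. h' (orbit \<pi> a))"
      have "h x = h' x" if "x \<in> ?P" for x
      proof -
        obtain a where "a \<in> A" "x = orbit \<pi> a" using \<open>x \<in> ?P\<close> by (rule imageE)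
        then show ?thesis using fun_cong[OF eq, of a] by simp
      qed
      then show "h = h'" using h h' by (meson PiE_ext)
    qed simp
  next
    fix h assume h: "h \<in> ?P \<rightarrow>\<^sub>E {..<N}"
    have "orbit \<pi> (\<pi> a) = orbit \<pi> a" for a
      using permutation_orbit_step[OF perm] by blast
    then show "(\<lambda>a\<in>A. h (orbit \<pi> a)) \<in> colorings N A \<pi>"
      using h permutes_in_image[OF assms(1)] by (auto simp: colorings_def)
  next
    fix f assume f: "f \<in> colorings N A \<pi>"
    have *: "f (SOME b. b \<in> orbit \<pi> a) = f a" if "a \<in> A" for a
      using const[OF f that] someI[of "\<lambda>b. b \<in> orbit \<pi> a", OF self] by blast
    have "(\<lambda>x\<in>?P. f (SOME b. b \<in> x)) \<in> ?P \<rightarrow>\<^sub>E {..<N}"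
      using * colorings_less[OF f] by auto
    moreover have "f = (\<lambda>a\<in>A. (\<lambda>x\<in>?P. f (SOME b. b \<in> x)) (orbit \<pi> a))"
    proof
      fix a
      show "f a = (\<lambda>a\<in>A. (\<lambda>x\<in>?P. f (SOME b. b \<in> x)) (orbit \<pi> a)) a"
      proof (cases "a \<in> A")
        case True then show ?thesis using * by simp
      next
        case False then show ?thesis using f by (auto simp: colorings_def PiE_def extensional_def)
      qed
    qed
    ultimately show "\<exists>h\<in>?P \<rightarrow>\<^sub>E {..<N}. f = (\<lambda>a\<in>A. h (orbit \<pi> a))" by blast
  qed
  then have "card (colorings N A \<pi>) = card (?P \<rightarrow>\<^sub>E {..<N})" by (simp add: bij_betw_same_card)
  then show ?thesis using assms by (simp add: card_PiE)
qed

text \<open>This is \<open>\<pi>\<close> with \<open>m\<close> cut out of its cycle and left as a fixed point.\<close>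

definition delete :: "'a \<Rightarrow> ('a \<Rightarrow> 'a) \<Rightarrow> 'a \<Rightarrow> 'a" where
  "delete m \<pi> = transpose m (\<pi> m) \<circ> \<pi>"

lemma delete_permutes:
  assumes "\<pi> permutes A" "m \<in> A"
  shows "delete m \<pi> permutes (A - {m})"
proof -
  have "delete m \<pi> permutes A"
    unfolding delete_def using assms
    by (intro permutes_compose permutes_swap_id) (auto simp: permutes_in_image)
  then show ?thesis
    by (rule permutes_superset) (auto simp: delete_def)
qed

lemma delete_apply:
  assumes "\<pi> permutes A" "a \<noteq> m"
  shows "delete m \<pi> a = (if \<pi> a = m then \<pi> m else \<pi> a)"
proof -
  have "\<pi> a \<noteq> \<pi> m" using assms permutes_inj[OF assms(1)] by (auto dest: injD)
  then show ?thesis by (auto simp: delete_def Transposition.transpose_def)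
qed

text \<open>The colour of \<open>m\<close> is forced by the rest of its cycle, unless \<open>m\<close> is a cycle of its own, in
  which case all \<open>N\<close> colours are possible.\<close>

lemma sum_colorings_delete:
  fixes h :: "('a \<Rightarrow> nat) \<Rightarrow> real"
  assumes "\<pi> permutes A" "m \<in> A" "finite A"
  shows "(\<Sum>f\<in>colorings N A \<pi>. h (restrict f (A - {m}))) =
    (if \<pi> m = m then real N else 1) * (\<Sum>g\<in>colorings N (A - {m}) (delete m \<pi>). h g)"
proof -
  let ?B = "A - {m}"
  have inA: "a \<in> A \<Longrightarrow> \<pi> a \<in> A" for a using assms by (simp add: permutes_in_image)
  have upd_restrict: "restrict (g(m := c)) ?B = g" if "g \<in> ?B \<rightarrow>\<^sub>E {..<N}" for g :: "'a \<Rightarrow> nat" and c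
    using that by (auto simp: PiE_def extensional_def)
  have restrict_upd: "(restrict f ?B)(m := f m) = f" if "f \<in> colorings N A \<pi>" for f
    using that assms by (auto simp: colorings_def PiE_def extensional_def)
  have sub: "restrict f ?B \<in> colorings N ?B (delete m \<pi>)" if f: "f \<in> colorings N A \<pi>" for f
  proof -
    have "f (delete m \<pi> a) = f a" if "a \<in> ?B" for a
      using that f assms inA delete_apply[OF assms(1), of a m] by (metis Diff_iff colorings_step singletonI)
    moreover have "delete m \<pi> a \<in> ?B" if "a \<in> ?B" for a
      using delete_permutes[OF assms(1,2)] that by (simp only: permutes_in_image)
    ultimately show ?thesis using f by (auto simp: colorings_def)
  qed
  show ?thesis
  proof (cases "\<pi> m = m")
    case True
    have fix_inv: "\<pi> a = m \<longleftrightarrow> a = m" for a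
      using True injD[OF permutes_inj[OF assms(1)], of a m] by auto
    have ext: "g(m := c) \<in> colorings N A \<pi>" if "g \<in> colorings N ?B (delete m \<pi>)" "c < N" for g c
      using that assms True delete_apply[OF assms(1)] fix_inv
      by (auto simp: colorings_def PiE_def extensional_def Pi_def)
    have "(\<Sum>f\<in>colorings N A \<pi>. h (restrict f ?B)) =
      (\<Sum>(g, c)\<in>colorings N ?B (delete m \<pi>) \<times> {..<N}. h g)"
      by (rule sum.reindex_bij_witness[where j = "\<lambda>f. (restrict f ?B, f m)" and i = "\<lambda>(g, c). g(m := c)"])
        (use sub ext restrict_upd upd_restrict assms in \<open>auto simp: colorings_less colorings_def[of N "A - {m}"]\<close>)
    also have "\<dots> = real N * (\<Sum>g\<in>colorings N ?B (delete m \<pi>). h g)"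
      by (simp add: sum.cartesian_product[symmetric] sum_distrib_left)
    finally show ?thesis using True by simp
  next
    case False
    then have Bm: "\<pi> m \<in> ?B" using assms inA by auto
    have ext: "g(m := g (\<pi> m)) \<in> colorings N A \<pi>" if g: "g \<in> colorings N ?B (delete m \<pi>)" for g
    proof -
      have "g (\<pi> m) < N" using colorings_less[OF g Bm] .
      moreover have "(g(m := g (\<pi> m))) (\<pi> a) = (g(m := g (\<pi> m))) a" if "a \<in> A" for a
        using that colorings_step[OF g, of a] delete_apply[OF assms(1), of a m] False by (auto split: if_splits)
      ultimately show ?thesis
        using g assms(2) by (auto simp: colorings_def PiE_def extensional_def Pi_def)
    qed
    have "(\<Sum>f\<in>colorings N A \<pi>. h (restrict f ?B)) = (\<Sum>g\<in>colorings N ?B (delete m \<pi>). h g)"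
    proof (rule sum.reindex_bij_witness[where j = "\<lambda>f. restrict f ?B" and i = "\<lambda>g. g(m := g (\<pi> m))"])
      fix f assume f: "f \<in> colorings N A \<pi>"
      have "restrict f ?B (\<pi> m) = f m" using f Bm assms by (simp add: colorings_step)
      then show "(restrict f ?B)(m := restrict f ?B (\<pi> m)) = f" using restrict_upd[OF f] by simp
    qed (use sub ext upd_restrict in \<open>auto simp: colorings_def[of N "A - {m}"]\<close>)
    then show ?thesis using False by simp
  qed
qed

lemma bij_betw_colorings_conj:
  fixes g :: "'a \<Rightarrow> 'a"
  assumes "bij g" "\<And>a. a \<in> A \<Longrightarrow> \<pi> a \<in> A" "g ` A = B"
  shows "bij_betw (\<lambda>f. restrict (f \<circ> g) A) (colorings N B (g \<circ> \<pi> \<circ> inv g)) (colorings N A \<pi>)"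
proof (rule bij_betw_byWitness[where f' = "\<lambda>f. restrict (f \<circ> inv g) B"])
  have gi: "inv g (g a) = a" "g (inv g a) = a" for a
    using assms(1) by (auto simp: bij_is_inj bij_is_surj surj_f_inv_f)
  have inB: "b \<in> B \<longleftrightarrow> inv g b \<in> A" for b using assms(3) gi by (metis image_iff)
  have inA: "g a \<in> B \<longleftrightarrow> a \<in> A" for a using inB gi by simp
  note [simp] = gi inB inA
  show "\<forall>f\<in>colorings N B (g \<circ> \<pi> \<circ> inv g). restrict (restrict (f \<circ> g) A \<circ> inv g) B = f"
    by (auto simp: colorings_def PiE_def extensional_def fun_eq_iff)
  show "\<forall>f\<in>colorings N A \<pi>. restrict (restrict (f \<circ> inv g) B \<circ> g) A = f"
    by (auto simp: colorings_def PiE_def extensional_def fun_eq_iff)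
  show "(\<lambda>f. restrict (f \<circ> g) A) ` colorings N B (g \<circ> \<pi> \<circ> inv g) \<subseteq> colorings N A \<pi>"
  proof (clarify)
    fix f assume f: "f \<in> colorings N B (g \<circ> \<pi> \<circ> inv g)"
    have "f (g (\<pi> a)) = f (g a)" if "a \<in> A" for a
      using colorings_step[OF f, of "g a"] that by simp
    then show "restrict (f \<circ> g) A \<in> colorings N A \<pi>"
      using f assms(2) by (auto simp: colorings_def PiE_def Pi_def)
  qed
  show "(\<lambda>f. restrict (f \<circ> inv g) B) ` colorings N A \<pi> \<subseteq> colorings N B (g \<circ> \<pi> \<circ> inv g)"
    using assms(2) by (auto simp: colorings_def PiE_def Pi_def)
qed

section \<open>Power sums acting on alternants\<close>

text \<open>An exponent vector \<open>\<gamma>\<close> stands for the alternant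
  \<open>a\<^sub>\<gamma> = (\<Sum>u. sign u * (\<Prod>i<N. x\<^sub>u\<^sub>(\<^sub>i\<^sub>) ^ \<gamma> i))\<close> in the variables \<open>x\<^sub>0, \<dots>, x\<^sub>N\<^sub>-\<^sub>1\<close>. A linear functional on the
  antisymmetric polynomials is given by its values \<open>e \<gamma>\<close> at the alternants, which change sign when two
  of the first \<open>N\<close> entries of \<open>\<gamma>\<close> are exchanged. Identities between antisymmetric polynomials are
  expressed as identities that hold for every \<open>e\<close> of this kind.\<close>

definition alternating :: "nat \<Rightarrow> ((nat \<Rightarrow> nat) \<Rightarrow> real) \<Rightarrow> bool" where
  "alternating N e \<longleftrightarrow> (\<forall>\<gamma> i j. i < N \<longrightarrow> j < N \<longrightarrow> i \<noteq> j \<longrightarrow> e (\<gamma> \<circ> transpose i j) = - e \<gamma>)"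

definition add_content :: "'a set \<Rightarrow> ('a \<Rightarrow> nat) \<Rightarrow> (nat \<Rightarrow> nat) \<Rightarrow> nat \<Rightarrow> nat" where
  "add_content A f \<gamma> i = \<gamma> i + card {a \<in> A. f a = i}"

text \<open>The power sum \<open>p\<^sub>\<pi>\<close>, the product of \<open>x\<^sub>0 ^ k + \<dots> + x\<^sub>N\<^sub>-\<^sub>1 ^ k\<close> over the cycle lengths \<open>k\<close> of \<open>\<pi>\<close>, is
  the sum over all colourings of the monomials with the content of the colouring as exponents.
  Hence this is the functional \<open>e\<close> evaluated at the product of \<open>p\<^sub>\<pi>\<close> and the alternant of \<open>\<gamma>\<close>. The
  vector \<open>id\<close> has the entries \<open>0, \<dots>, N - 1\<close> and so stands for the Vandermonde determinant.\<close>

definition psum :: "nat \<Rightarrow> 'a set \<Rightarrow> ('a \<Rightarrow> 'a) \<Rightarrow> ((nat \<Rightarrow> nat) \<Rightarrow> real) \<Rightarrow> (nat \<Rightarrow> nat) \<Rightarrow> real" where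
  "psum N A \<pi> e \<gamma> = (\<Sum>f\<in>colorings N A \<pi>. e (add_content A f \<gamma>))"

definition raise :: "nat \<Rightarrow> nat \<Rightarrow> (nat \<Rightarrow> nat) \<Rightarrow> nat \<Rightarrow> nat" where
  "raise k i \<gamma> = \<gamma>(i := \<gamma> i + k)"

lemma alternating_swap: 
  "alternating N e \<Longrightarrow> i < N \<Longrightarrow> j < N \<Longrightarrow> i \<noteq> j \<Longrightarrow> e (\<gamma> \<circ> transpose i j) = - e \<gamma>"
  by (auto simp: alternating_def)

lemma alternating_zero:
  assumes "alternating N e" "i < N" "j < N" "i \<noteq> j" "\<gamma> i = \<gamma> j"
  shows "e \<gamma> = 0"
proof -
  have "\<gamma> \<circ> transpose i j = \<gamma>" using assms(5) by (auto simp: Transposition.transpose_def fun_eq_iff)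
  then show ?thesis using alternating_swap[OF assms(1-4), of \<gamma>] by simp
qed

lemma psum_cong:
  assumes "\<And>a. a \<in> A \<Longrightarrow> \<pi> a = \<pi>' a"
  shows "psum N A \<pi> e \<gamma> = psum N A \<pi>' e \<gamma>"
  by (simp add: psum_def colorings_cong[OF assms])

lemma psum_conj:
  fixes g :: "'a \<Rightarrow> 'a"
  assumes "bij g" "\<And>a. a \<in> A \<Longrightarrow> \<pi> a \<in> A" "g ` A = B"
  shows "psum N B (g \<circ> \<pi> \<circ> inv g) e \<gamma> = psum N A \<pi> e \<gamma>"
proof -
  have "add_content B f \<gamma> = add_content A (restrict (f \<circ> g) A) \<gamma>" for f
  proof
    fix i
    have "{b \<in> B. f b = i} = g ` {a \<in> A. restrict (f \<circ> g) A a = i}"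
      using assms(3) by auto
    then show "add_content B f \<gamma> i = add_content A (restrict (f \<circ> g) A) \<gamma> i"
      using card_image[OF inj_on_subset[OF bij_is_inj[OF assms(1)] subset_UNIV]]
      by (simp only: add_content_def)
  qed
  then show ?thesis
    unfolding psum_def
    using sum.reindex_bij_betw[OF bij_betw_colorings_conj[OF assms, where N = N], where g = "\<lambda>f. e (add_content A f \<gamma>)"]
    by simp
qed

text \<open>A power sum is symmetric, so multiplication by it preserves antisymmetry: permuting the colours
  permutes the colourings.\<close>

lemma alternating_psum:
  assumes e: "alternating N e" and inv: "\<pi> ` A \<subseteq> A"
  shows "alternating N (psum N A \<pi> e)"
  unfolding alternating_def
proof (intro allI impI)
  fix \<gamma> :: "nat \<Rightarrow> nat" and i j assume ij: "i < N" "j < N" "i \<noteq> j"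
  let ?t = "transpose i j"
  have less: "?t c < N \<longleftrightarrow> c < N" for c using ij by (auto simp: Transposition.transpose_def)
  have sw: "add_content A f (\<gamma> \<circ> ?t) = add_content A (restrict (?t \<circ> f) A) \<gamma> \<circ> ?t" for f
  proof
    fix k
    have "{a \<in> A. f a = k} = {a \<in> A. restrict (?t \<circ> f) A a = ?t k}"
      by (auto simp: Transposition.transpose_def)
    then show "add_content A f (\<gamma> \<circ> ?t) k = (add_content A (restrict (?t \<circ> f) A) \<gamma> \<circ> ?t) k"
      by (simp add: add_content_def)
  qed
  have tt: "restrict (?t \<circ> restrict (?t \<circ> f) A) A = f" if "f \<in> colorings N A \<pi>" for f
    using that by (auto simp: colorings_def PiE_def extensional_def fun_eq_iff)
  have mem: "restrict (?t \<circ> f) A \<in> colorings N A \<pi>" if "f \<in> colorings N A \<pi>" for f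
    using that inv less by (auto simp: colorings_def)
  have "psum N A \<pi> e (\<gamma> \<circ> ?t) = (\<Sum>f\<in>colorings N A \<pi>. - e (add_content A (restrict (?t \<circ> f) A) \<gamma>))"
    unfolding psum_def sw using alternating_swap[OF e ij] by simp
  also have "\<dots> = - psum N A \<pi> e \<gamma>"
    unfolding psum_def sum_negf
    by (intro arg_cong[where f = uminus] sum.reindex_bij_witness[where i = "\<lambda>f. restrict (?t \<circ> f) A" and j = "\<lambda>f. restrict (?t \<circ> f) A"])
      (use mem tt in auto)
  finally show "psum N A \<pi> e (\<gamma> \<circ> ?t) = - psum N A \<pi> e \<gamma>" .
qed

lemma sum_colorings_union:
  assumes "B \<inter> C = {}" "\<pi> ` B \<subseteq> B" "\<pi> ` C \<subseteq> C"
  shows "(\<Sum>F\<in>colorings N (B \<union> C) \<pi>. h (restrict F B) (restrict F C)) =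
    (\<Sum>f\<in>colorings N B \<pi>. \<Sum>g\<in>colorings N C \<pi>. h f g)"
proof -
  let ?j = "\<lambda>F. (restrict F B, restrict F C)"
  let ?i = "\<lambda>(f, g) a. if a \<in> B then f a else g a"
  have nB: "\<And>a. a \<in> C \<Longrightarrow> a \<notin> B" using assms by auto
  have "(\<Sum>F\<in>colorings N (B \<union> C) \<pi>. h (restrict F B) (restrict F C)) =
    (\<Sum>(f, g)\<in>colorings N B \<pi> \<times> colorings N C \<pi>. h f g)"
  proof (rule sum.reindex_bij_witness[where j = ?j and i = ?i])
    fix F assume F: "F \<in> colorings N (B \<union> C) \<pi>"
    show "?i (?j F) = F" using F by (auto simp: colorings_def PiE_def extensional_def fun_eq_iff)
    show "?j F \<in> colorings N B \<pi> \<times> colorings N C \<pi>"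
      using F assms(2,3) by (auto simp: colorings_def)
    show "(case ?j F of (f, g) \<Rightarrow> h f g) = h (restrict F B) (restrict F C)" by simp
  next
    fix p assume p: "p \<in> colorings N B \<pi> \<times> colorings N C \<pi>"
    show "?j (?i p) = p"
      using p nB by (auto simp: colorings_def PiE_def extensional_def fun_eq_iff)
    show "?i p \<in> colorings N (B \<union> C) \<pi>"
      using p nB assms(2,3) by (auto simp: colorings_def PiE_def Pi_def extensional_def image_subset_iff)
  qed
  then show ?thesis by (simp add: sum.cartesian_product)
qed

lemma add_content_union:
  assumes "finite B" "finite C" "B \<inter> C = {}"
  shows "add_content (B \<union> C) F \<gamma> = add_content C (restrict F C) (add_content B (restrict F B) \<gamma>)"
proof
  fix i
  have "{a \<in> B \<union> C. F a = i} = {a \<in> B. restrict F B a = i} \<union> {a \<in> C. restrict F C a = i}" by auto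
  moreover have "card \<dots> = card {a \<in> B. restrict F B a = i} + card {a \<in> C. restrict F C a = i}"
    using assms by (intro card_Un_disjoint) auto
  ultimately show "add_content (B \<union> C) F \<gamma> i = add_content C (restrict F C) (add_content B (restrict F B) \<gamma>) i"
    by (simp add: add_content_def)
qed

lemma psum_union:
  assumes "finite B" "finite C" "B \<inter> C = {}" "\<pi> ` B \<subseteq> B" "\<pi> ` C \<subseteq> C"
  shows "psum N (B \<union> C) \<pi> e \<gamma> = psum N B \<pi> (psum N C \<pi> e) \<gamma>"
  using sum_colorings_union[OF assms(3-5), of "\<lambda>f g. e (add_content C g (add_content B f \<gamma>))" N]
  by (simp add: psum_def add_content_union[OF assms(1-3)])

text \<open>On a single cycle the admissible colourings are the constant ones.\<close>

lemma sum_colorings_cycle: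
  assumes "0 < k" "\<And>r. Suc r < k \<Longrightarrow> \<pi> (y r) = y (Suc r)" "\<pi> (y (k - 1)) = y 0"
  shows "(\<Sum>f\<in>colorings N (y ` {..<k}) \<pi>. h f) = (\<Sum>c<N. h (\<lambda>a\<in>y ` {..<k}. c))"
proof -
  let ?C = "y ` {..<k}"
  have const: "f a = f (y 0)" if f: "f \<in> colorings N ?C \<pi>" and a: "a \<in> ?C" for f a
  proof -
    have "f (y r) = f (y 0)" if "r < k" for r
      using that
    proof (induction r)
      case (Suc r)
      then show ?case using colorings_step[OF f, of "y r"] assms(2)[of r] by auto
    qed simp
    then show ?thesis using a by auto
  qed
  have y0: "y 0 \<in> ?C" using assms(1) by auto
  have step: "\<pi> a \<in> ?C" if "a \<in> ?C" for a
  proof -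
    obtain r where r: "r < k" "a = y r" using \<open>a \<in> ?C\<close> by auto
    show ?thesis
    proof (cases "Suc r < k")
      case True then show ?thesis using r assms(2) by auto
    next
      case False then have "r = k - 1" using r by auto
      then show ?thesis using r assms(3) y0 by auto
    qed
  qed
  show ?thesis
  proof (rule sum.reindex_bij_witness[where j = "\<lambda>f. f (y 0)" and i = "\<lambda>c. \<lambda>a\<in>?C. c"])
    fix f assume f: "f \<in> colorings N ?C \<pi>"
    show *: "(\<lambda>a\<in>?C. f (y 0)) = f"
    proof
      fix a show "(\<lambda>a\<in>?C. f (y 0)) a = f a"
        using const[OF f, of a] f by (cases "a \<in> ?C") (auto simp: colorings_def PiE_def extensional_def)
    qed
    show "f (y 0) \<in> {..<N}" using colorings_less[OF f y0] by simp
    show "h (\<lambda>a\<in>?C. f (y 0)) = h f" unfolding * ..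
  next
    fix c assume c: "c \<in> {..<N}"
    show "(\<lambda>a\<in>?C. c) (y 0) = c" using y0 by simp
    show "(\<lambda>a\<in>?C. c) \<in> colorings N ?C \<pi>" using c step by (auto simp: colorings_def)
  qed
qed

lemma add_content_const:
  assumes "inj_on y {..<k}"
  shows "add_content (y ` {..<k}) (\<lambda>a\<in>y ` {..<k}. c) \<gamma> = raise k c \<gamma>"
proof
  fix i
  have "{a \<in> y ` {..<k}. (\<lambda>a\<in>y ` {..<k}. c) a = i} = (if i = c then y ` {..<k} else {})" by auto
  then show "add_content (y ` {..<k}) (\<lambda>a\<in>y ` {..<k}. c) \<gamma> i = raise k c \<gamma> i"
    using card_image[OF assms] by (simp add: add_content_def raise_def)
qed

lemma psum_cycle:
  assumes "0 < k" "inj_on y {..<k}" "\<And>r. Suc r < k \<Longrightarrow> \<pi> (y r) = y (Suc r)" "\<pi> (y (k - 1)) = y 0"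
  shows "psum N (y ` {..<k}) \<pi> e \<gamma> = (\<Sum>c<N. e (raise k c \<gamma>))"
  unfolding psum_def
  by (subst sum_colorings_cycle) (use assms in \<open>auto simp: add_content_const\<close>)

lemma orbit_enum:
  assumes "\<pi> permutes A" "finite A"
  obtains k where "0 < k" "orbit \<pi> i = (\<lambda>r. (\<pi> ^^ r) i) ` {..<k}" "inj_on (\<lambda>r. (\<pi> ^^ r) i) {..<k}"
    "(\<pi> ^^ k) i = i"
proof -
  have "permutation \<pi>" using assms permutation_permutes by blast
  then have self: "i \<in> orbit \<pi> i" by (rule permutation_self_in_orbit)
  show thesis
  proof (rule that[of "funpow_dist1 \<pi> i i"])
    show "orbit \<pi> i = (\<lambda>r. (\<pi> ^^ r) i) ` {..<funpow_dist1 \<pi> i i}"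
      using orbit_conv_funpow_dist1[OF self] by (simp add: atLeast0LessThan)
    show "inj_on (\<lambda>r. (\<pi> ^^ r) i) {..<funpow_dist1 \<pi> i i}"
      using inj_on_funpow_dist1[OF self] by (simp add: atLeast0LessThan)
    show "(\<pi> ^^ funpow_dist1 \<pi> i i) i = i"
      using funpow_dist1_prop[OF self] .
  qed simp
qed

section \<open>Transpositions and the Vandermonde determinant\<close>

text \<open>Let \<open>u\<close> and \<open>i + j + k - u\<close> be the entries at the positions \<open>i\<close> and \<open>j\<close>. Exchanging them changes
  the sign, so the sum over the symmetric range \<open>i \<le> u \<le> j + k\<close> vanishes. The sum in question covers
  \<open>i \<le> u \<le> i + k\<close>; among the remaining \<open>u\<close> the entry at \<open>j\<close> already occurs elsewhere in the
  vector, except for \<open>u = j + k\<close>, which is the vector on the right-hand side with two entries exchanged.\<close>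

lemma alternating_interpolate:
  assumes e: "alternating N e" and "i < j" "j < N"
  shows "(\<Sum>s\<le>k. e (raise s i (raise (k - s) j id))) = e (raise k j id)"
proof -
  define \<phi> where "\<phi> u = e (id(i := u, j := i + j + k - u))" for u
  have ij: "i < N" "j < N" "i \<noteq> j" using assms by auto
  have refl: "\<phi> (i + j + k - u) = - \<phi> u" if "u \<le> i + j + k" for u
  proof -
    have "id(i := i + j + k - u, j := i + j + k - (i + j + k - u)) = id(i := u, j := i + j + k - u) \<circ> transpose i j"
      using that ij by (auto simp: Transposition.transpose_def fun_eq_iff)
    then show ?thesis unfolding \<phi>_def using alternating_swap[OF e ij] by metis
  qed
  have "(\<Sum>u\<in>{i..j + k}. \<phi> u) = (\<Sum>u\<in>{i..j + k}. \<phi> (i + j + k - u))"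
    by (rule sum.reindex_bij_witness[where i = "\<lambda>u. i + j + k - u" and j = "\<lambda>u. i + j + k - u"]) auto
  also have "\<dots> = - (\<Sum>u\<in>{i..j + k}. \<phi> u)"
    unfolding sum_negf[symmetric] using refl by (intro sum.cong) auto
  finally have all: "(\<Sum>u\<in>{i..j + k}. \<phi> u) = 0" by simp
  have mid: "\<phi> u = 0" if "u \<in> {i + k<..<j + k}" for u
    unfolding \<phi>_def
    by (rule alternating_zero[OF e, of j "i + j + k - u"]) (use that assms in auto)
  have "(\<Sum>s\<le>k. e (raise s i (raise (k - s) j id))) = (\<Sum>u\<in>{i..i + k}. \<phi> u)"
    by (rule sum.reindex_bij_witness[where i = "\<lambda>u. u - i" and j = "\<lambda>s. i + s"])
      (use ij in \<open>auto simp: \<phi>_def raise_def intro!: arg_cong[where f = e]\<close>)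
  also have "\<dots> = - \<phi> (j + k)"
  proof -
    have "{i..j + k} = {i..i + k} \<union> ({i + k<..<j + k} \<union> {j + k})" using assms by auto
    then have "(\<Sum>u\<in>{i..j + k}. \<phi> u) = (\<Sum>u\<in>{i..i + k}. \<phi> u) + ((\<Sum>u\<in>{i + k<..<j + k}. \<phi> u) + \<phi> (j + k))"
      using assms by (simp add: sum.union_disjoint ivl_disj_int)
    then show ?thesis using all mid by simp
  qed
  also have "\<dots> = \<phi> i" using refl[of i] by (simp add: ac_simps)
  also have "\<dots> = e (raise k j id)"
    unfolding \<phi>_def raise_def by (intro arg_cong[where f = e]) (auto simp: fun_eq_iff)
  finally show ?thesis .
qed

lemma raise_commute: "raise a i (raise b j \<gamma>) = raise b j (raise a i \<gamma>)"
  by (auto simp: raise_def fun_eq_iff)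

lemma raise_raise: "raise a i (raise b i \<gamma>) = raise (a + b) i \<gamma>"
  by (auto simp: raise_def fun_eq_iff)

lemma raise_0 [simp]: "raise 0 i \<gamma> = \<gamma>"
  by (auto simp: raise_def)

text \<open>In polynomials, with \<open>a\<close> the Vandermonde determinant and \<open>p\<^sub>k\<close> the \<open>k\<close>-th power sum, this
  expresses \<open>(\<Sum>s\<in>{1..<k}. p\<^sub>s * p\<^sub>k\<^sub>-\<^sub>s) * a\<close> through the alternants that arise from \<open>a\<close> by
  raising a single exponent by \<open>k\<close>. When \<open>s\<close> runs from \<open>0\<close> to \<open>k\<close>, the pair \<open>c \<noteq> c'\<close> contributes just the
  alternant in which the larger of the two is raised, so that \<open>c\<close> is raised \<open>2 * c\<close> times.\<close>

lemma sum_raise_raise: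
  assumes e: "alternating N e" and "0 < k"
  shows "(\<Sum>s\<in>{1..<k}. \<Sum>c<N. \<Sum>c'<N. e (raise s c (raise (k - s) c' id))) =
    (\<Sum>c<N. (2 * real c + real k - 1 - (2 * real N - 2)) * e (raise k c id))"
proof -
  define E where "E s c c' = e (raise s c (raise (k - s) c' id))" for s c c'
  define p where "p c = e (raise k c id)" for c
  have pair: "(\<Sum>s\<le>k. E s c c') = (if c = c' then real (k + 1) * p c else p (max c c'))"
    if "c < N" "c' < N" for c c'
  proof -
    consider "c < c'" | "c' < c" | "c = c'" by linarith
    then show ?thesis
    proof cases
      case 1 then show ?thesis using alternating_interpolate[OF e 1 that(2)] by (simp add: E_def p_def)
    next
      case 2
      have "(\<Sum>s\<le>k. E s c c') = (\<Sum>s\<le>k. e (raise s c' (raise (k - s) c id)))"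
        by (rule sum.reindex_bij_witness[where i = "\<lambda>s. k - s" and j = "\<lambda>s. k - s"])
          (auto simp: E_def raise_commute)
      also have "\<dots> = p c" using alternating_interpolate[OF e 2 that(1)] by (simp add: p_def)
      finally show ?thesis using 2 by simp
    next
      case 3
      then show ?thesis by (simp add: E_def p_def raise_raise)
    qed
  qed
  have ends: "(\<Sum>s\<le>k. E s c c') = (\<Sum>s\<in>{1..<k}. E s c c') + (p c + p c')" for c c'
  proof -
    have "{..k} = insert 0 (insert k {1..<k})" using assms by auto
    then show ?thesis using assms by (simp add: E_def p_def)
  qed
  have mx: "(\<Sum>c'<N. if c = c' then real (k + 1) * p c else p (max c c')) = real k * p c + (\<Sum>c'<N. p (max c c'))"
    if "c < N" for c
  proof -
    have "(\<Sum>c'<N. if c = c' then real (k + 1) * p c else p (max c c')) =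
      (\<Sum>c'<N. (if c = c' then real k * p c else 0) + p (max c c'))"
      by (intro sum.cong) (auto simp: algebra_simps)
    then show ?thesis using that by (simp add: sum.distrib)
  qed
  have max_sum: "(\<Sum>c<n. \<Sum>c'<n. p (max c c')) = (\<Sum>c<n. (2 * real c + 1) * p c)" for n
  proof (induction n)
    case (Suc n)
    have "(\<Sum>c<n. p (max c n)) = real n * p n" "(\<Sum>c<n. p (max n c)) = real n * p n"
      by (simp_all add: max_def)
    then show ?case using Suc by (simp add: sum.distrib algebra_simps)
  qed simp
  have "(\<Sum>c<N. \<Sum>c'<N. \<Sum>s\<le>k. E s c c') = (\<Sum>c<N. (2 * real c + 1 + real k) * p c)"
    using pair mx by (simp add: sum.distrib max_sum algebra_simps)
  moreover have "(\<Sum>c<N. \<Sum>c'<N. \<Sum>s\<le>k. E s c c') =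
      (\<Sum>s\<in>{1..<k}. \<Sum>c<N. \<Sum>c'<N. E s c c') + 2 * real N * (\<Sum>c<N. p c)"
  proof -
    have "(\<Sum>c<N. \<Sum>c'<N. \<Sum>s\<in>{1..<k}. E s c c') = (\<Sum>s\<in>{1..<k}. \<Sum>c<N. \<Sum>c'<N. E s c c')"
      by (simp only: sum.swap[of _ "{1..<k}"])
    then show ?thesis by (simp add: ends sum.distrib sum_distrib_left[symmetric])
  qed
  ultimately show ?thesis
    by (simp add: E_def p_def algebra_simps sum.distrib sum_subtractf sum_distrib_left)
qed

text \<open>Multiplication by a transposition of points in different cycles joins these cycles.\<close>

lemma colorings_transpose_merge:
  assumes \<pi>: "\<pi> permutes A" "finite A" and ij: "i \<in> A" "j \<in> A" "j \<notin> orbit \<pi> i"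
  shows "colorings N A (transpose i j \<circ> \<pi>) = {f \<in> colorings N A \<pi>. f i = f j}"
proof (intro equalityI subsetI)
  fix f assume "f \<in> {f \<in> colorings N A \<pi>. f i = f j}"
  then have f: "f \<in> colorings N A \<pi>" and fij: "f i = f j" by auto
  have "f (transpose i j (\<pi> a)) = f a" if "a \<in> A" for a
  proof -
    have "f (transpose i j b) = f b" for b
      using fij by (cases "b = i"; cases "b = j") auto
    then show ?thesis using colorings_step[OF f that] by simp
  qed
  then show "f \<in> colorings N A (transpose i j \<circ> \<pi>)"
    using f by (auto simp: colorings_def)
next
  fix f assume f: "f \<in> colorings N A (transpose i j \<circ> \<pi>)"
  obtain k where k: "0 < k" "orbit \<pi> i = (\<lambda>r. (\<pi> ^^ r) i) ` {..<k}" "inj_on (\<lambda>r. (\<pi> ^^ r) i) {..<k}"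
    "(\<pi> ^^ k) i = i"
    using orbit_enum[OF \<pi>] by blast
  have inA: "(\<pi> ^^ r) i \<in> A" for r
    using ij permutes_in_image[OF permutes_funpow[OF \<pi>(1)]] by blast
  have const: "f ((\<pi> ^^ r) i) = f i" if "r < k" for r
    using that
  proof (induction r)
    case (Suc r)
    have "(\<pi> ^^ Suc r) i \<noteq> i" using inj_onD[OF k(3), of "Suc r" 0] Suc.prems by auto
    moreover have "(\<pi> ^^ Suc r) i \<noteq> j" using ij(3) Suc.prems unfolding k(2) by blast
    ultimately show ?case using Suc colorings_step[OF f inA[of r]] by simp
  qed simp
  have "(\<pi> ^^ Suc (k - 1)) i = i" using k by simp
  then have "f j = f ((\<pi> ^^ (k - 1)) i)" using colorings_step[OF f inA[of "k - 1"]] by simp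
  then have fij: "f i = f j" using const[of "k - 1"] k(1) by simp
  have "f (\<pi> a) = f a" if "a \<in> A" for a
  proof -
    have "f (transpose i j b) = f b" for b
      using fij by (cases "b = i"; cases "b = j") auto
    then show ?thesis using colorings_step[OF f that] by simp
  qed
  then show "f \<in> {f \<in> colorings N A \<pi>. f i = f j}" using f fij by (auto simp: colorings_def)
qed

text \<open>If \<open>j\<close> lies \<open>s\<close> steps after \<open>i\<close> on a cycle of length \<open>k\<close>, multiplication by the transposition
  splits this cycle into cycles of lengths \<open>s\<close> and \<open>k - s\<close>. The resulting products of two power sums
  are brought back to a single one by the previous identity, at the price of weights that depend
  on the colour of \<open>i\<close>.\<close>

lemma psum_transpose_cut:
  assumes \<pi>: "\<pi> permutes A" "finite A" and i: "i \<in> A" and e: "alternating N e"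
  shows "(\<Sum>j\<in>orbit \<pi> i. psum N A (transpose i j \<circ> \<pi>) e id) =
    (\<Sum>f\<in>colorings N A \<pi>. (2 * real (f i) + real (card (orbit \<pi> i)) - (2 * real N - 2)) * e (add_content A f id))"
proof -
  define O' where "O' = orbit \<pi> i"
  define y where "y r = (\<pi> ^^ r) i" for r
  obtain k where k: "0 < k" "O' = y ` {..<k}" "inj_on y {..<k}" "y k = i"
    using orbit_enum[OF \<pi>, of i] unfolding O'_def y_def by blast
  have yS: "\<pi> (y r) = y (Suc r)" for r by (simp add: y_def)
  have y0: "y 0 = i" by (simp add: y_def)
  have OA: "O' \<subseteq> A" unfolding O'_def using permutes_orbit_subset[OF \<pi>(1) i] .
  define R where "R = A - O'"
  have A: "A = R \<union> O'" "R \<inter> O' = {}" and fin: "finite R" "finite O'"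
    using OA \<pi>(2) by (auto simp: R_def intro: finite_subset)
  have \<pi>O: "\<pi> ` O' \<subseteq> O'" unfolding O'_def by (auto intro: orbit.step)
  have \<pi>R: "\<pi> ` R \<subseteq> R"
  proof -
    have "\<pi> ` O' = O'" using \<pi>O fin permutes_inj_on[OF \<pi>(1)] by (simp add: endo_inj_surj)
    then have "\<pi> a \<in> O' \<longleftrightarrow> a \<in> O'" for a
      using inj_image_mem_iff[OF permutes_inj[OF \<pi>(1)], of a O'] by simp
    then show ?thesis using permutes_in_image[OF \<pi>(1)] by (auto simp: R_def)
  qed
  \<comment> \<open>the cycles other than that of \<open>i\<close> can be multiplied in first\<close>
  define e' where "e' = psum N R \<pi> e"
  have e': "alternating N e'" unfolding e'_def using e \<pi>R by (rule alternating_psum)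
  have split: "psum N A \<kappa> e \<gamma> = psum N O' \<kappa> e' \<gamma>"
    if "\<And>a. a \<in> R \<Longrightarrow> \<kappa> a = \<pi> a" "\<kappa> ` O' \<subseteq> O'" for \<kappa> \<gamma>
  proof -
    have "\<kappa> ` R \<subseteq> R" using that(1) \<pi>R by auto
    have "psum N (O' \<union> R) \<kappa> e \<gamma> = psum N O' \<kappa> (psum N R \<kappa> e) \<gamma>"
      using A fin that \<open>\<kappa> ` R \<subseteq> R\<close> by (intro psum_union) auto
    also have "psum N R \<kappa> e = e'" unfolding e'_def using psum_cong[OF that(1)] by (auto simp: fun_eq_iff)
    finally show ?thesis using A by (simp add: Un_commute)
  qed
  have yO: "y r \<in> O'" if "r < k" for r using that k(2) by auto
  have split': "psum N A (transpose i (y s) \<circ> \<pi>) e \<gamma> = psum N O' (transpose i (y s) \<circ> \<pi>) e' \<gamma>"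
    if "s < k" for s \<gamma>
  proof (rule split)
    show "(transpose i (y s) \<circ> \<pi>) a = \<pi> a" if "a \<in> R" for a
    proof -
      have "\<pi> a \<notin> O'" using that \<pi>R A by auto
      then have "\<pi> a \<noteq> i" "\<pi> a \<noteq> y s" using yO[of 0] yO[of s] y0 \<open>s < k\<close> k(1) by auto
      then show ?thesis by simp
    qed
    show "(transpose i (y s) \<circ> \<pi>) ` O' \<subseteq> O'"
      using \<pi>O yO[of 0] yO[of s] y0 that k(1) by (auto simp: Transposition.transpose_def)
  qed
  have yinj: "y r = y s \<longleftrightarrow> r = s" if "r < k" "s < k" for r s
    using inj_onD[OF k(3)] that by auto
  have cut0: "psum N O' (transpose i (y 0) \<circ> \<pi>) e' \<gamma> = (\<Sum>c<N. e' (raise k c \<gamma>))" for \<gamma>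
    unfolding k(2) by (rule psum_cycle) (use k yS y0 in auto)
  have cut: "psum N O' (transpose i (y s) \<circ> \<pi>) e' id =
      (\<Sum>c<N. \<Sum>c'<N. e' (raise s c (raise (k - s) c' id)))" if s: "s \<in> {1..<k}" for s
  proof -
    let ?\<kappa> = "transpose i (y s) \<circ> \<pi>" and ?y' = "\<lambda>r. y (s + r)"
    have sk: "0 < s" "s < k" using s by auto
    have step: "?\<kappa> (y r) = y (Suc r)" if "Suc r < k" "Suc r \<noteq> s" for r
      using that yinj[of "Suc r" 0] yinj[of "Suc r" s] sk y0 by (simp add: yS)
    have last1: "?\<kappa> (y (s - 1)) = y 0" using sk y0 by (simp add: yS)
    have last2: "?\<kappa> (?y' (k - s - 1)) = ?y' 0" using sk y0 k(4) by (simp add: yS)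
    have img: "?y' ` {..<k - s} = y ` {s..<k}"
    proof -
      have "{s..<k} = (+) s ` {..<k - s}" using sk by (simp add: lessThan_atLeast0)
      then show ?thesis by (simp add: image_image)
    qed
    have O': "O' = y ` {..<s} \<union> ?y' ` {..<k - s}"
      unfolding k(2) img using sk by (auto simp: image_Un[symmetric] ivl_disj_un)
    have disj: "y ` {..<s} \<inter> ?y' ` {..<k - s} = {}"
      unfolding img using sk yinj by auto
    have inj1: "inj_on y {..<s}" and inj2: "inj_on ?y' {..<k - s}"
      using sk by (auto intro!: inj_onI simp: yinj)
    have st1: "?\<kappa> (y r) = y (Suc r)" if "Suc r < s" for r using step[of r] that sk by simp
    have st2: "?\<kappa> (?y' r) = ?y' (Suc r)" if "Suc r < k - s" for r using step[of "s + r"] that sk by simp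
    have im1: "?\<kappa> ` y ` {..<s} \<subseteq> y ` {..<s}"
    proof (clarify)
      fix r assume r: "r < s"
      show "?\<kappa> (y r) \<in> y ` {..<s}"
      proof (cases "Suc r < s")
        case True then show ?thesis unfolding st1[OF True] by (intro imageI) simp
      next
        case False
        then have "r = s - 1" using r by auto
        show ?thesis unfolding \<open>r = s - 1\<close> last1 using sk by (intro imageI) simp
      qed
    qed
    have im2: "?\<kappa> ` ?y' ` {..<k - s} \<subseteq> ?y' ` {..<k - s}"
    proof (clarify)
      fix r assume r: "r < k - s"
      show "?\<kappa> (?y' r) \<in> ?y' ` {..<k - s}"
      proof (cases "Suc r < k - s")
        case True then show ?thesis unfolding st2[OF True] by (intro imageI) simp
      next
        case False
        then have "r = k - s - 1" using r by auto
        show ?thesis unfolding \<open>r = k - s - 1\<close> last2 using sk by (intro imageI) simp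
      qed
    qed
    have "psum N O' ?\<kappa> e' id = psum N (y ` {..<s}) ?\<kappa> (psum N (?y' ` {..<k - s}) ?\<kappa> e') id"
      unfolding O' by (rule psum_union) (use disj im1 im2 in auto)
    also have "\<dots> = (\<Sum>c<N. psum N (?y' ` {..<k - s}) ?\<kappa> e' (raise s c id))"
      by (rule psum_cycle) (use sk inj1 st1 last1 in auto)
    also have "\<dots> = (\<Sum>c<N. \<Sum>c'<N. e' (raise (k - s) c' (raise s c id)))"
      by (intro sum.cong refl psum_cycle) (use sk inj2 st2 last2 in auto)
    finally show ?thesis by (simp add: raise_commute)
  qed
  have "(\<Sum>j\<in>O'. psum N A (transpose i j \<circ> \<pi>) e id) =
      (\<Sum>s<k. psum N O' (transpose i (y s) \<circ> \<pi>) e' id)"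
    using split' by (simp add: k(2) sum.reindex[OF k(3)])
  also have "{..<k} = insert 0 {1..<k}" using k(1) by auto
  also have "(\<Sum>s\<in>insert 0 {1..<k}. psum N O' (transpose i (y s) \<circ> \<pi>) e' id) =
      (\<Sum>c<N. e' (raise k c id)) + (\<Sum>s\<in>{1..<k}. \<Sum>c<N. \<Sum>c'<N. e' (raise s c (raise (k - s) c' id)))"
    using cut by (simp add: cut0)
  also have "\<dots> = (\<Sum>c<N. (2 * real c + real k - (2 * real N - 2)) * e' (raise k c id))"
    unfolding sum_raise_raise[OF e' k(1)] sum.distrib[symmetric]
    by (intro sum.cong) (auto simp: algebra_simps)
  also have "\<dots> = (\<Sum>f\<in>colorings N A \<pi>. (2 * real (f i) + real k - (2 * real N - 2)) * e (add_content A f id))"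
  proof -
    have i_O: "i \<in> O'" using yO[of 0] y0 k(1) by simp
    have last: "\<pi> (y (k - 1)) = y 0" using yS[of "k - 1"] k y0 by simp
    let ?w = "\<lambda>c. 2 * real c + real k - (2 * real N - 2)"
    have "(\<Sum>f\<in>colorings N A \<pi>. ?w (f i) * e (add_content A f id)) =
      (\<Sum>f\<in>colorings N (O' \<union> R) \<pi>. ?w (restrict f O' i) *
        e (add_content R (restrict f R) (add_content O' (restrict f O') id)))"
      using A fin i_O add_content_union[of O' R] by (simp add: Un_commute Int_commute)
    also have "\<dots> = (\<Sum>f\<in>colorings N O' \<pi>. \<Sum>g\<in>colorings N R \<pi>. ?w (f i) * e (add_content R g (add_content O' f id)))"
      using A \<pi>O \<pi>R by (intro sum_colorings_union) auto
    also have "\<dots> = (\<Sum>f\<in>colorings N O' \<pi>. ?w (f i) * e' (add_content O' f id))"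
      by (simp add: e'_def psum_def sum_distrib_left)
    also have "\<dots> = (\<Sum>c<N. ?w c * e' (raise k c id))"
      unfolding k(2) sum_colorings_cycle[of k \<pi> y, OF k(1) yS last]
      using i_O by (simp add: add_content_const[OF k(3)] k(2))
    finally show ?thesis by simp
  qed
  also have "k = card (orbit \<pi> i)"
    using card_image[OF k(3)] k(2) by (simp add: O'_def)
  finally show ?thesis by (simp only: O'_def)
qed


lemma sum_color_classes:
  fixes g :: "nat \<Rightarrow> real"
  assumes "finite A" "\<And>a. a \<in> A \<Longrightarrow> f a < N"
  shows "(\<Sum>c<N. real (card {a \<in> A. f a = c}) * g c) = (\<Sum>a\<in>A. g (f a))"
proof -
  have "(\<Sum>a\<in>A. g (f a)) = (\<Sum>c<N. \<Sum>a | a \<in> A \<and> f a = c. g (f a))"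
    using assms by (intro sum.group[symmetric]) auto
  then show ?thesis by simp
qed

lemma psum_transpose_row:
  assumes \<pi>: "\<pi> permutes A" "finite A" and i: "i \<in> A" and e: "alternating N e"
  shows "(\<Sum>j\<in>A. psum N A (transpose i j \<circ> \<pi>) e id) =
    (\<Sum>f\<in>colorings N A \<pi>. (2 * real (f i) + real (card {j \<in> A. f j = f i}) - (2 * real N - 2)) * e (add_content A f id))"
proof -
  let ?O = "orbit \<pi> i"
  have OA: "?O \<subseteq> A" using permutes_orbit_subset[OF \<pi>(1) i] .
  have fO: "finite ?O" using OA \<pi>(2) by (rule finite_subset)
  have const: "f j = f i" if "f \<in> colorings N A \<pi>" "j \<in> ?O" for f j
  proof -
    obtain r where "j = (\<pi> ^^ r) i" using \<open>j \<in> ?O\<close> orbit_altdef[of \<pi> i] by auto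
    then show ?thesis using colorings_funpow[OF that(1) \<pi>(1) i] by simp
  qed
  have "(\<Sum>j\<in>A - ?O. psum N A (transpose i j \<circ> \<pi>) e id) =
      (\<Sum>j\<in>A - ?O. \<Sum>f\<in>colorings N A \<pi>. if f j = f i then e (add_content A f id) else 0)"
  proof (rule sum.cong[OF refl])
    fix j assume "j \<in> A - ?O"
    then have "colorings N A (transpose i j \<circ> \<pi>) = {f \<in> colorings N A \<pi>. f i = f j}"
      using colorings_transpose_merge[OF \<pi> i, of j N] by simp
    then show "psum N A (transpose i j \<circ> \<pi>) e id = (\<Sum>f\<in>colorings N A \<pi>. if f j = f i then e (add_content A f id) else 0)"
      unfolding psum_def using \<pi>(2) by (simp add: sum.inter_filter eq_commute)
  qed
  also have "\<dots> = (\<Sum>f\<in>colorings N A \<pi>. real (card {j \<in> A - ?O. f j = f i}) * e (add_content A f id))"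
  proof -
    have "(\<Sum>j\<in>A - ?O. if f j = f i then e (add_content A f id) else 0) =
      real (card {j \<in> A - ?O. f j = f i}) * e (add_content A f id)" for f
      using \<pi>(2) by (simp add: sum.inter_filter[symmetric])
    then show ?thesis by (subst sum.swap) simp
  qed
  finally have merge: "(\<Sum>j\<in>A - ?O. psum N A (transpose i j \<circ> \<pi>) e id) =
    (\<Sum>f\<in>colorings N A \<pi>. real (card {j \<in> A - ?O. f j = f i}) * e (add_content A f id))" .
  have count: "card {j \<in> A. f j = f i} = card ?O + card {j \<in> A - ?O. f j = f i}"
    if f: "f \<in> colorings N A \<pi>" for f
  proof -
    have "{j \<in> A. f j = f i} = ?O \<union> {j \<in> A - ?O. f j = f i}" using OA const[OF f] by auto
    then show ?thesis using fO \<pi>(2) by (simp add: card_Un_disjoint[of ?O] disjoint_iff)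
  qed
  have "(\<Sum>j\<in>A. psum N A (transpose i j \<circ> \<pi>) e id) =
      (\<Sum>j\<in>A - ?O. psum N A (transpose i j \<circ> \<pi>) e id) + (\<Sum>j\<in>?O. psum N A (transpose i j \<circ> \<pi>) e id)"
    using OA \<pi>(2) by (rule sum.subset_diff)
  then show ?thesis
    unfolding merge psum_transpose_cut[OF \<pi> i e] sum.distrib[symmetric]
    by (auto intro!: sum.cong simp: count algebra_simps)
qed

text \<open>The operator \<open>\<Sum>c<N. (x\<^sub>c * \<partial>\<^sub>c)\<^sup>2\<close> multiplies every alternant by the sum of the squares of its
  exponents. Applied to \<open>p\<^sub>\<pi>\<close> times the Vandermonde determinant it produces, up to a multiple of the
  argument, the sum over all products of \<open>\<pi>\<close> with transpositions: joins come from pairs of points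
  with equal colour, splits from the interaction with the Vandermonde determinant.\<close>

lemma psum_transposition_sum:
  assumes \<pi>: "\<pi> permutes A" "finite A" and e: "alternating N e"
  shows "(\<Sum>i\<in>A. \<Sum>j\<in>A. psum N A (transpose i j \<circ> \<pi>) e id) =
    (\<Sum>f\<in>colorings N A \<pi>. ((\<Sum>c<N. (real (add_content A f id c))\<^sup>2) -
      ((\<Sum>c<N. (real c)\<^sup>2) + (2 * real N - 2) * real (card A))) * e (add_content A f id))"
proof -
  have sq: "(\<Sum>c<N. (real (add_content A f id c))\<^sup>2) - ((\<Sum>c<N. (real c)\<^sup>2) + (2 * real N - 2) * real (card A)) =
      (\<Sum>i\<in>A. 2 * real (f i) + real (card {j \<in> A. f j = f i}) - (2 * real N - 2))"
    if f: "f \<in> colorings N A \<pi>" for f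
  proof -
    let ?n = "\<lambda>c. real (card {a \<in> A. f a = c})"
    have "(\<Sum>c<N. (real (add_content A f id c))\<^sup>2) = (\<Sum>c<N. (real c)\<^sup>2) + (\<Sum>c<N. ?n c * (2 * real c + ?n c))"
      unfolding sum.distrib[symmetric] by (intro sum.cong) (auto simp: add_content_def power2_eq_square algebra_simps)
    also have "(\<Sum>c<N. ?n c * (2 * real c + ?n c)) = (\<Sum>a\<in>A. 2 * real (f a) + ?n (f a))"
      using sum_color_classes[OF \<pi>(2), of f N "\<lambda>c. 2 * real c + ?n c"] colorings_less[OF f] by simp
    finally show ?thesis by (simp add: sum_subtractf id_def)
  qed
  have "(\<Sum>i\<in>A. \<Sum>j\<in>A. psum N A (transpose i j \<circ> \<pi>) e id) =
    (\<Sum>i\<in>A. \<Sum>f\<in>colorings N A \<pi>. (2 * real (f i) + real (card {j \<in> A. f j = f i}) - (2 * real N - 2)) * e (add_content A f id))"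
    using psum_transpose_row[OF \<pi> _ e] by simp
  also have "\<dots> = (\<Sum>f\<in>colorings N A \<pi>. (\<Sum>i\<in>A. 2 * real (f i) + real (card {j \<in> A. f j = f i}) - (2 * real N - 2)) * e (add_content A f id))"
    by (subst sum.swap) (simp add: sum_distrib_right)
  finally show ?thesis using sq by simp
qed

section \<open>The Fischer pairing\<close>

text \<open>The Fischer inner product, for which distinct monomials are orthogonal and
  \<open>x\<^sup>\<alpha>\<close> has squared norm \<open>\<Prod>i. fact (\<alpha> i)\<close>, of the alternants of \<open>\<gamma>\<close> and \<open>\<gamma>'\<close>, divided by \<open>fact N\<close>. What
  singles it out is that multiplication by \<open>x\<^sub>i\<close> is adjoint to differentiation by \<open>x\<^sub>i\<close>.\<close>

definition pairing :: "nat \<Rightarrow> (nat \<Rightarrow> nat) \<Rightarrow> (nat \<Rightarrow> nat) \<Rightarrow> real" where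
  "pairing N \<gamma> \<gamma>' = (\<Sum>u | u permutes {..<N}. if \<gamma>' = \<gamma> \<circ> u then of_int (sign u) * (\<Prod>i<N. fact (\<gamma> i)) else 0)"

lemma alternating_pairing: "alternating N (pairing N \<gamma>)"
  unfolding alternating_def
proof (intro allI impI)
  fix \<gamma>' i j assume ij: "i < N" "j < N" "i \<noteq> (j::nat)"
  let ?t = "transpose i j"
  have t: "?t permutes {..<N}" using ij by (intro permutes_swap_id) auto
  have perm: "permutation u" if "u permutes {..<N}" for u using that permutation_permutes by blast
  have comp: "\<gamma>' \<circ> ?t = \<gamma> \<circ> (u \<circ> ?t) \<longleftrightarrow> \<gamma>' = \<gamma> \<circ> u" for u
  proof
    assume "\<gamma>' \<circ> ?t = \<gamma> \<circ> (u \<circ> ?t)"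
    then have "\<gamma>' \<circ> ?t \<circ> ?t = \<gamma> \<circ> (u \<circ> ?t) \<circ> ?t" by simp
    then show "\<gamma>' = \<gamma> \<circ> u" by (simp add: comp_assoc)
  qed (simp add: comp_assoc)
  have "pairing N \<gamma> (\<gamma>' \<circ> ?t) = (\<Sum>u | u permutes {..<N}. - (if \<gamma>' = \<gamma> \<circ> u then of_int (sign u) * (\<Prod>i<N. fact (\<gamma> i)) else 0))"
    unfolding pairing_def
  proof (rule sum.reindex_bij_witness[where i = "\<lambda>u. u \<circ> ?t" and j = "\<lambda>u. u \<circ> ?t"])
    fix u assume u: "u \<in> {u. u permutes {..<N}}"
    then show "u \<circ> ?t \<circ> ?t = u" "u \<circ> ?t \<circ> ?t = u" by (simp_all add: comp_assoc)
    show "u \<circ> ?t \<in> {u. u permutes {..<N}}" "u \<circ> ?t \<in> {u. u permutes {..<N}}"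
      using u t by (auto intro: permutes_compose)
    have "sign (u \<circ> ?t) = - sign u"
      using u perm t ij by (simp add: sign_compose sign_swap_id)
    moreover have "\<gamma>' = \<gamma> \<circ> (u \<circ> ?t) \<longleftrightarrow> \<gamma>' \<circ> ?t = \<gamma> \<circ> u"
      using comp[of "u \<circ> ?t"] by (simp add: comp_assoc)
    ultimately show "- (if \<gamma>' = \<gamma> \<circ> (u \<circ> ?t) then of_int (sign (u \<circ> ?t)) * (\<Prod>i<N. fact (\<gamma> i)) else 0) =
      ((if \<gamma>' \<circ> ?t = \<gamma> \<circ> u then of_int (sign u) * (\<Prod>i<N. fact (\<gamma> i)) else 0) :: real)"
      by auto
  qed
  then show "pairing N \<gamma> (\<gamma>' \<circ> ?t) = - pairing N \<gamma> \<gamma>'"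
    by (simp add: pairing_def sum_negf)
qed

lemma prod_permuted:
  assumes "u permutes {..<N}"
  shows "(\<Prod>i<N. g (u i)) = (\<Prod>i<N. g i)"
  using prod.permute[OF assms, of g] by simp

lemma pairing_sym: "pairing N \<gamma> \<gamma>' = pairing N \<gamma>' \<gamma>"
  unfolding pairing_def
proof (rule sum.reindex_bij_witness[where i = inv and j = inv])
  fix u assume "u \<in> {u. u permutes {..<N}}"
  then have u: "u permutes {..<N}" by simp
  show "inv (inv u) = u" "inv (inv u) = u" using u by (auto simp: permutes_inv_inv)
  show "inv u \<in> {u. u permutes {..<N}}" "inv u \<in> {u. u permutes {..<N}}" using u by (auto intro: permutes_inv)
  have "\<gamma> = \<gamma>' \<circ> inv u \<longleftrightarrow> \<gamma>' = \<gamma> \<circ> u"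
    using permutes_inv_o[OF u] by (metis comp_assoc comp_id)
  moreover have "(\<Prod>i<N. fact ((\<gamma> \<circ> u) i)) = (\<Prod>i<N. fact (\<gamma> i) :: real)"
    using prod_permuted[OF u, of "\<lambda>i. fact (\<gamma> i)"] by simp
  moreover have "sign (inv u) = sign u" using u permutation_permutes by (blast intro: sign_inverse)
  ultimately show "(if \<gamma> = \<gamma>' \<circ> inv u then of_int (sign (inv u)) * (\<Prod>i<N. fact (\<gamma>' i)) else 0) =
     ((if \<gamma>' = \<gamma> \<circ> u then of_int (sign u) * (\<Prod>i<N. fact (\<gamma> i)) else 0) :: real)"
    by auto
qed

text \<open>The adjoint of multiplication by \<open>x\<^sub>0 + \<dots> + x\<^sub>N\<^sub>-\<^sub>1\<close> is the sum of the partial derivatives. Where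
  \<open>\<gamma>' c = 0\<close> the truncated difference is harmless because of the factor \<open>\<gamma>' c\<close>.\<close>

lemma pairing_raise:
  "(\<Sum>c<N. pairing N (raise 1 c \<gamma>) \<gamma>') = (\<Sum>c<N. real (\<gamma>' c) * pairing N \<gamma> (\<gamma>'(c := \<gamma>' c - 1)))"
proof -
  let ?P = "\<Prod>i<N. fact (\<gamma> i) :: real"
  have *: "(\<Sum>c<N. if \<gamma>' = raise 1 c \<gamma> \<circ> u then of_int (sign u) * (\<Prod>i<N. fact (raise 1 c \<gamma> i)) else 0) =
      (\<Sum>c<N. real (\<gamma>' c) * (if \<gamma>'(c := \<gamma>' c - 1) = \<gamma> \<circ> u then of_int (sign u) * ?P else 0))"
    if u: "u permutes {..<N}" for u
  proof -
    have "(\<Sum>c<N. if \<gamma>' = raise 1 c \<gamma> \<circ> u then of_int (sign u) * (\<Prod>i<N. fact (raise 1 c \<gamma> i)) else 0) =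
      (\<Sum>c<N. if \<gamma>' = raise 1 (u c) \<gamma> \<circ> u then of_int (sign u) * (\<Prod>i<N. fact (raise 1 (u c) \<gamma> i)) else (0::real))"
      using sum.permute[OF u] by (simp add: comp_def)
    also have "\<dots> = (\<Sum>c<N. real (\<gamma>' c) * (if \<gamma>'(c := \<gamma>' c - 1) = \<gamma> \<circ> u then of_int (sign u) * ?P else 0))"
    proof (rule sum.cong[OF refl])
      fix c assume c: "c \<in> {..<N}"
      have uc: "u c \<in> {..<N}" using c u by (simp only: permutes_in_image)
      have "raise 1 (u c) \<gamma> \<circ> u = raise 1 c (\<gamma> \<circ> u)"
        using permutes_inj[OF u] by (auto simp: raise_def fun_eq_iff dest: injD)
      moreover have "\<gamma>' = raise 1 c (\<gamma> \<circ> u) \<longleftrightarrow> \<gamma>' c \<noteq> 0 \<and> \<gamma>'(c := \<gamma>' c - 1) = \<gamma> \<circ> u"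
        by (auto simp: raise_def fun_eq_iff)
      moreover have "(\<Prod>i<N. fact (raise 1 (u c) \<gamma> i)) = (real (\<gamma> (u c)) + 1) * ?P"
      proof -
        have "(\<Prod>i<N. fact (raise 1 (u c) \<gamma> i)) = (\<Prod>i<N. fact (\<gamma> i) * (if i = u c then real (\<gamma> i) + 1 else 1))"
          by (intro prod.cong) (auto simp: raise_def)
        then show ?thesis using uc by (simp add: prod.distrib)
      qed
      moreover have "real (\<gamma>' c) = real (\<gamma> (u c)) + 1" if "\<gamma>' c \<noteq> 0" "\<gamma>'(c := \<gamma>' c - 1) = \<gamma> \<circ> u"
        using fun_cong[OF that(2), of c] that(1) by simp
      ultimately show "(if \<gamma>' = raise 1 (u c) \<gamma> \<circ> u then of_int (sign u) * (\<Prod>i<N. fact (raise 1 (u c) \<gamma> i)) else 0) =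
        real (\<gamma>' c) * (if \<gamma>'(c := \<gamma>' c - 1) = \<gamma> \<circ> u then of_int (sign u) * ?P else 0)"
        by auto
    qed
    finally show ?thesis .
  qed
  have "(\<Sum>c<N. pairing N (raise 1 c \<gamma>) \<gamma>') = (\<Sum>u | u permutes {..<N}.
      \<Sum>c<N. if \<gamma>' = raise 1 c \<gamma> \<circ> u then of_int (sign u) * (\<Prod>i<N. fact (raise 1 c \<gamma> i)) else 0)"
    unfolding pairing_def by (rule sum.swap)
  also have "\<dots> = (\<Sum>u | u permutes {..<N}.
      \<Sum>c<N. real (\<gamma>' c) * (if \<gamma>'(c := \<gamma>' c - 1) = \<gamma> \<circ> u then of_int (sign u) * ?P else 0))"
    by (intro sum.cong refl *) simp
  also have "\<dots> = (\<Sum>c<N. real (\<gamma>' c) * pairing N \<gamma> (\<gamma>'(c := \<gamma>' c - 1)))"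
    unfolding pairing_def sum_distrib_left by (rule sum.swap)
  finally show ?thesis .
qed

text \<open>Alternants pair to zero unless their exponents agree up to order; hence operators that are
  diagonal on alternants with symmetric eigenvalues are self-adjoint.\<close>

lemma pairing_sum_squares:
  assumes "pairing N \<gamma> \<gamma>' \<noteq> 0"
  shows "(\<Sum>c<N. (real (\<gamma> c))\<^sup>2) = (\<Sum>c<N. (real (\<gamma>' c))\<^sup>2)"
proof -
  have "\<exists>u. u permutes {..<N} \<and> \<gamma>' = \<gamma> \<circ> u"
  proof (rule ccontr)
    assume "\<nexists>u. u permutes {..<N} \<and> \<gamma>' = \<gamma> \<circ> u"
    then have "pairing N \<gamma> \<gamma>' = 0" unfolding pairing_def by (intro sum.neutral) auto
    then show False using assms by simp
  qed
  then obtain u where u: "u permutes {..<N}" "\<gamma>' = \<gamma> \<circ> u" by blast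
  then show ?thesis using sum.permute[OF u(1), of "\<lambda>c. (real (\<gamma> c))\<^sup>2"] by (simp add: comp_def)
qed

section \<open>Sums over conjugates as Fischer pairings\<close>

text \<open>With \<open>a\<close> the Vandermonde determinant, the Fischer product of \<open>p\<^sub>\<tau> * a\<close> and \<open>p\<^sub>\<rho> * a\<close>, divided by
  \<open>fact N\<close>.\<close>

definition psum_pairing :: "nat \<Rightarrow> 'a set \<Rightarrow> ('a \<Rightarrow> 'a) \<Rightarrow> ('a \<Rightarrow> 'a) \<Rightarrow> real" where
  "psum_pairing N A \<tau> \<rho> = psum N A \<tau> (\<lambda>\<gamma>. psum N A \<rho> (pairing N \<gamma>) id) id"

definition conj_sum :: "nat \<Rightarrow> 'a set \<Rightarrow> ('a \<Rightarrow> 'a) \<Rightarrow> ('a \<Rightarrow> 'a) \<Rightarrow> real" where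
  "conj_sum N A \<tau> \<rho> = (\<Sum>\<sigma> | \<sigma> permutes A. real (card (colorings N A (\<sigma> \<circ> \<tau> \<circ> inv \<sigma> \<circ> \<rho>))))"

lemma alternating_psum_pairing: "alternating N (\<lambda>\<gamma>. psum N A \<rho> (pairing N \<gamma>) id)"
  unfolding alternating_def
proof (intro allI impI)
  fix \<gamma> i j assume ij: "i < N" "j < N" "i \<noteq> (j::nat)"
  have "pairing N (\<gamma> \<circ> transpose i j) \<gamma>' = - pairing N \<gamma> \<gamma>'" for \<gamma>'
    using alternating_swap[OF alternating_pairing ij] by (metis pairing_sym)
  then show "psum N A \<rho> (pairing N (\<gamma> \<circ> transpose i j)) id = - psum N A \<rho> (pairing N \<gamma>) id"
    by (simp add: psum_def sum_negf)
qed

text \<open>By the transposition formula both sides insert the same self-adjoint operator between \<open>p\<^sub>\<tau>\<close> and \<open>p\<^sub>\<rho>\<close>.\<close>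

lemma psum_pairing_transpositions:
  assumes "\<tau> permutes A" "\<rho> permutes A" "finite A"
  shows "(\<Sum>i\<in>A. \<Sum>j\<in>A. psum_pairing N A (transpose i j \<circ> \<tau>) \<rho>) =
    (\<Sum>i\<in>A. \<Sum>j\<in>A. psum_pairing N A \<tau> (transpose i j \<circ> \<rho>))"
proof -
  let ?K = "(\<Sum>c<N. (real c)\<^sup>2) + (2 * real N - 2) * real (card A)"
  let ?q = "\<lambda>\<gamma>. (\<Sum>c<N. (real (\<gamma> c))\<^sup>2) - ?K"
  let ?c = "\<lambda>f. add_content A f id"
  have pq: "?q \<gamma> * pairing N \<gamma> \<gamma>' = ?q \<gamma>' * pairing N \<gamma> \<gamma>'" for \<gamma> \<gamma>'
    using pairing_sum_squares[of N \<gamma> \<gamma>'] by (cases "pairing N \<gamma> \<gamma>' = 0") auto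
  have "(\<Sum>i\<in>A. \<Sum>j\<in>A. psum_pairing N A (transpose i j \<circ> \<tau>) \<rho>) =
    (\<Sum>f\<in>colorings N A \<tau>. ?q (?c f) * psum N A \<rho> (pairing N (?c f)) id)"
    unfolding psum_pairing_def
    by (rule psum_transposition_sum[OF assms(1,3) alternating_psum_pairing])
  also have "\<dots> = (\<Sum>f\<in>colorings N A \<tau>. \<Sum>g\<in>colorings N A \<rho>. ?q (?c g) * pairing N (?c f) (?c g))"
    unfolding psum_def sum_distrib_left pq ..
  also have "\<dots> = (\<Sum>f\<in>colorings N A \<tau>. \<Sum>i\<in>A. \<Sum>j\<in>A. psum N A (transpose i j \<circ> \<rho>) (pairing N (?c f)) id)"
    using psum_transposition_sum[OF assms(2,3) alternating_pairing] by simp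
  also have "\<dots> = (\<Sum>i\<in>A. \<Sum>j\<in>A. psum_pairing N A \<tau> (transpose i j \<circ> \<rho>))"
    unfolding psum_pairing_def psum_def[of N A \<tau>] by (subst sum.swap) (simp add: sum.swap[of _ A "colorings N A \<tau>"])
  finally show ?thesis .
qed

text \<open>The sum of all transpositions is central in the group algebra.\<close>

lemma conj_sum_transpositions:
  assumes "\<tau> permutes A" "\<rho> permutes A" "finite A"
  shows "(\<Sum>i\<in>A. \<Sum>j\<in>A. conj_sum N A (transpose i j \<circ> \<tau>) \<rho>) =
    (\<Sum>i\<in>A. \<Sum>j\<in>A. conj_sum N A \<tau> (transpose i j \<circ> \<rho>))"
proof -
  have comm: "\<pi> (transpose i j x) = transpose (\<pi> i) (\<pi> j) (\<pi> x)" if "\<pi> permutes A" for \<pi> i j x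
    using transpose_apply_commute[OF permutes_bij[OF that], of "\<pi> i" "\<pi> j" x] permutes_inverses(2)[OF that] by simp
  have pairs: "(\<Sum>i\<in>A. \<Sum>j\<in>A. F (\<pi> i) (\<pi> j)) = (\<Sum>i\<in>A. \<Sum>j\<in>A. F i j)" if "\<pi> permutes A"
    for \<pi> and F :: "'a \<Rightarrow> 'a \<Rightarrow> real"
  proof -
    have "(\<Sum>i\<in>A. \<Sum>j\<in>A. F (\<pi> i) (\<pi> j)) = (\<Sum>i\<in>A. \<Sum>j\<in>A. F (\<pi> i) j)"
      by (intro sum.cong refl sum.permute[OF that, unfolded comp_def, symmetric])
    also have "\<dots> = (\<Sum>i\<in>A. \<Sum>j\<in>A. F i j)"
      using sum.permute[OF that, of "\<lambda>i. \<Sum>j\<in>A. F i j"] by (simp add: comp_def)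
    finally show ?thesis .
  qed
  have *: "(\<Sum>i\<in>A. \<Sum>j\<in>A. real (card (colorings N A (\<sigma> \<circ> (transpose i j \<circ> \<tau>) \<circ> inv \<sigma> \<circ> \<rho>)))) =
    (\<Sum>i\<in>A. \<Sum>j\<in>A. real (card (colorings N A (\<sigma> \<circ> \<tau> \<circ> inv \<sigma> \<circ> (transpose i j \<circ> \<rho>)))))"
    if \<sigma>: "\<sigma> permutes A" for \<sigma>
  proof -
    let ?\<pi> = "\<sigma> \<circ> \<tau> \<circ> inv \<sigma>"
    have \<pi>: "?\<pi> permutes A" using \<sigma> assms by (auto intro!: permutes_compose permutes_inv)
    have 1: "\<sigma> \<circ> (transpose i j \<circ> \<tau>) \<circ> inv \<sigma> \<circ> \<rho> = transpose (\<sigma> i) (\<sigma> j) \<circ> (?\<pi> \<circ> \<rho>)" for i j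
      by (simp add: fun_eq_iff comm[OF \<sigma>])
    have 2: "?\<pi> \<circ> (transpose i j \<circ> \<rho>) = transpose (?\<pi> i) (?\<pi> j) \<circ> (?\<pi> \<circ> \<rho>)" for i j
      using comm[OF \<pi>] by (simp add: fun_eq_iff)
    show ?thesis
      unfolding 1 2
      using pairs[OF \<sigma>, of "\<lambda>i j. real (card (colorings N A (transpose i j \<circ> (?\<pi> \<circ> \<rho>))))"]
        pairs[OF \<pi>, of "\<lambda>i j. real (card (colorings N A (transpose i j \<circ> (?\<pi> \<circ> \<rho>))))"]
      by simp
  qed
  have "(\<Sum>i\<in>A. \<Sum>j\<in>A. conj_sum N A (transpose i j \<circ> \<tau>) \<rho>) = (\<Sum>\<sigma> | \<sigma> permutes A.
      \<Sum>i\<in>A. \<Sum>j\<in>A. real (card (colorings N A (\<sigma> \<circ> (transpose i j \<circ> \<tau>) \<circ> inv \<sigma> \<circ> \<rho>))))"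
    unfolding conj_sum_def by (simp only: sum.swap[of _ "{\<sigma>. \<sigma> permutes A}" A])
  also have "\<dots> = (\<Sum>\<sigma> | \<sigma> permutes A.
      \<Sum>i\<in>A. \<Sum>j\<in>A. real (card (colorings N A (\<sigma> \<circ> \<tau> \<circ> inv \<sigma> \<circ> (transpose i j \<circ> \<rho>)))))"
    by (intro sum.cong refl *) simp
  also have "\<dots> = (\<Sum>i\<in>A. \<Sum>j\<in>A. conj_sum N A \<tau> (transpose i j \<circ> \<rho>))"
    unfolding conj_sum_def by (simp only: sum.swap[of _ "{\<sigma>. \<sigma> permutes A}" A])
  finally show ?thesis .
qed

lemma conj_sum_conj:
  assumes "g permutes A"
  shows "conj_sum N A (g \<circ> \<tau> \<circ> inv g) \<rho> = conj_sum N A \<tau> \<rho>"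
  unfolding conj_sum_def
proof (rule sum.reindex_bij_witness[where i = "\<lambda>\<sigma>. \<sigma> \<circ> inv g" and j = "\<lambda>\<sigma>. \<sigma> \<circ> g"])
  fix \<sigma> assume "\<sigma> \<in> {\<sigma>. \<sigma> permutes A}"
  then have \<sigma>: "\<sigma> permutes A" by simp
  show "\<sigma> \<circ> g \<circ> inv g = \<sigma>" "\<sigma> \<circ> inv g \<circ> g = \<sigma>"
    using permutes_inv_o[OF assms] by (simp_all add: comp_assoc)
  show "\<sigma> \<circ> g \<in> {\<sigma>. \<sigma> permutes A}" "\<sigma> \<circ> inv g \<in> {\<sigma>. \<sigma> permutes A}"
    using \<sigma> assms by (auto intro: permutes_compose permutes_inv)
  have "inv (\<sigma> \<circ> g) = inv g \<circ> inv \<sigma>"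
    using permutes_bij[OF \<sigma>] permutes_bij[OF assms] by (rule o_inv_distrib)
  then show "real (card (colorings N A (\<sigma> \<circ> g \<circ> \<tau> \<circ> inv (\<sigma> \<circ> g) \<circ> \<rho>))) =
    real (card (colorings N A (\<sigma> \<circ> (g \<circ> \<tau> \<circ> inv g) \<circ> inv \<sigma> \<circ> \<rho>)))"
    by (simp add: comp_assoc)
qed

lemma psum_pairing_conj:
  assumes "g permutes A" "\<tau> permutes A"
  shows "psum_pairing N A (g \<circ> \<tau> \<circ> inv g) \<rho> = psum_pairing N A \<tau> \<rho>"
  unfolding psum_pairing_def
  by (rule psum_conj) (use assms in \<open>auto simp: permutes_bij permutes_in_image permutes_image\<close>)

lemma delete_conj:
  assumes "bij g"
  shows "g \<circ> delete j \<rho> \<circ> inv g = delete (g j) (g \<circ> \<rho> \<circ> inv g)"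
  using assms by (auto simp: fun_eq_iff delete_def transpose_apply_commute bij_is_inj)

lemma transpose_conj_permutes:
  assumes "\<rho> permutes A" "j \<in> A" "m \<in> A"
  shows "transpose j m \<circ> \<rho> \<circ> transpose j m permutes A"
  using assms by (auto intro!: permutes_compose permutes_swap_id)

text \<open>The number of colours that are possible at \<open>j\<close> once all other points have been coloured.\<close>

definition color_weight :: "nat \<Rightarrow> ('a \<Rightarrow> 'a) \<Rightarrow> 'a \<Rightarrow> real" where
  "color_weight N \<rho> j = (if \<rho> j = j then real N else 1)"

text \<open>A fixed point of \<open>\<tau>\<close> contributes a factor \<open>x\<^sub>0 + \<dots> + x\<^sub>N\<^sub>-\<^sub>1\<close>, which moves to the other side as the
  sum of the partial derivatives. This annihilates the Vandermonde determinant, and on the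
  monomials of \<open>p\<^sub>\<rho>\<close> it removes one point at a time. The conjugation by a transposition renames the
  removed point to \<open>m\<close>, so that both permutations live on the same smaller set.\<close>

lemma psum_pairing_fixpoint:
  assumes \<tau>: "\<tau> permutes A" "\<tau> m = m" and \<rho>: "\<rho> permutes A" and A: "finite A" "m \<in> A"
  shows "psum_pairing N A \<tau> \<rho> = (\<Sum>j\<in>A. color_weight N \<rho> j *
    psum_pairing N (A - {m}) \<tau> (delete m (transpose j m \<circ> \<rho> \<circ> transpose j m)))"
proof -
  let ?B = "A - {m}"
  let ?\<rho> = "\<lambda>j. delete m (transpose j m \<circ> \<rho> \<circ> transpose j m)"
  let ?c = "\<lambda>g. add_content A g id"
  have adjoint: "(\<Sum>c<N. psum N A \<rho> (pairing N (raise 1 c \<gamma>)) id) =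
      (\<Sum>j\<in>A. color_weight N \<rho> j * psum N ?B (?\<rho> j) (pairing N \<gamma>) id)" for \<gamma>
  proof -
    let ?e = "pairing N \<gamma>"
    let ?n = "\<lambda>g c. real (card {a \<in> A. g a = c})"
    let ?low = "\<lambda>g c. (?c g)(c := ?c g c - 1)"
    have "(\<Sum>c<N. psum N A \<rho> (pairing N (raise 1 c \<gamma>)) id) =
        (\<Sum>g\<in>colorings N A \<rho>. \<Sum>c<N. pairing N (raise 1 c \<gamma>) (?c g))"
      unfolding psum_def by (rule sum.swap)
    also have "\<dots> = (\<Sum>g\<in>colorings N A \<rho>. (\<Sum>c<N. real c * ?e (?low g c)) + (\<Sum>c<N. ?n g c * ?e (?low g c)))"
      unfolding pairing_raise by (simp add: add_content_def algebra_simps sum.distrib)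
    also have "\<dots> = (\<Sum>c<N. real c * (\<Sum>g\<in>colorings N A \<rho>. ?e (?low g c))) +
        (\<Sum>g\<in>colorings N A \<rho>. \<Sum>c<N. ?n g c * ?e (?low g c))"
      unfolding sum.distrib sum_distrib_left
      by (intro arg_cong2[where f = "(+)"] refl sum.swap)
    \<comment> \<open>lowering the entry \<open>c\<close> of \<open>id\<close> makes it equal to the entry \<open>c - 1\<close>\<close>
    also have "(\<Sum>c<N. real c * (\<Sum>g\<in>colorings N A \<rho>. ?e (?low g c))) = 0"
    proof (rule sum.neutral, rule ballI)
      fix c assume c: "c \<in> {..<N}"
      show "real c * (\<Sum>g\<in>colorings N A \<rho>. ?e (?low g c)) = 0"
      proof (cases c)
        case (Suc d)
        have "?low g c = add_content A g (id(c := c - 1))" for g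
          using Suc by (auto simp: add_content_def fun_eq_iff)
        then have "(\<Sum>g\<in>colorings N A \<rho>. ?e (?low g c)) = psum N A \<rho> ?e (id(c := c - 1))"
          by (simp add: psum_def)
        also have "\<dots> = 0"
        proof (rule alternating_zero[of N "psum N A \<rho> ?e" c d])
          show "alternating N (psum N A \<rho> ?e)"
            by (rule alternating_psum[OF alternating_pairing]) (use \<rho> in \<open>simp add: permutes_image\<close>)
        qed (use c Suc in auto)
        finally show ?thesis by simp
      qed simp
    qed
    also have "0 + (\<Sum>g\<in>colorings N A \<rho>. \<Sum>c<N. ?n g c * ?e (?low g c)) =
        (\<Sum>g\<in>colorings N A \<rho>. \<Sum>j\<in>A. ?e (add_content (A - {j}) (restrict g (A - {j})) id))"
    proof -
      have "(\<Sum>c<N. ?n g c * ?e (?low g c)) = (\<Sum>j\<in>A. ?e (add_content (A - {j}) (restrict g (A - {j})) id))"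
        if g: "g \<in> colorings N A \<rho>" for g
      proof -
        have "?low g (g j) = add_content (A - {j}) (restrict g (A - {j})) id" if j: "j \<in> A" for j
        proof
          fix c
          have "{a \<in> A. g a = c} = (if c = g j then {j} else {}) \<union> {a \<in> A - {j}. restrict g (A - {j}) a = c}"
            using j by auto
          then have "card {a \<in> A. g a = c} = (if c = g j then 1 else 0) + card {a \<in> A - {j}. restrict g (A - {j}) a = c}"
            using A(1) by (simp add: card_insert_if)
          then have "add_content A g id c = (if c = g j then 1 else 0) + add_content (A - {j}) (restrict g (A - {j})) id c"
            unfolding add_content_def by linarith
          then show "?low g (g j) c = add_content (A - {j}) (restrict g (A - {j})) id c"
            by (cases "c = g j") auto
        qed
        then show ?thesis
          using sum_color_classes[OF A(1), of g N "\<lambda>c. ?e (?low g c)"] colorings_less[OF g] by simp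
      qed
      then show ?thesis by simp
    qed
    also have "\<dots> = (\<Sum>j\<in>A. \<Sum>g\<in>colorings N A \<rho>. ?e (add_content (A - {j}) (restrict g (A - {j})) id))"
      by (rule sum.swap)
    also have "\<dots> = (\<Sum>j\<in>A. color_weight N \<rho> j * psum N ?B (?\<rho> j) ?e id)"
    proof (rule sum.cong[OF refl])
      fix j assume j: "j \<in> A"
      let ?t = "transpose j m"
      have "psum N ?B (?t \<circ> delete j \<rho> \<circ> inv ?t) ?e id = psum N (A - {j}) (delete j \<rho>) ?e id"
      proof (rule psum_conj)
        show "delete j \<rho> a \<in> A - {j}" if "a \<in> A - {j}" for a
          using delete_permutes[OF \<rho> j] that by (simp only: permutes_in_image)
        show "?t ` (A - {j}) = ?B"
          using j A(2) by (auto simp: Transposition.transpose_def image_iff split: if_splits)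
      qed simp
      moreover have "?t \<circ> delete j \<rho> \<circ> inv ?t = ?\<rho> j"
        using delete_conj[of ?t j \<rho>] by simp
      ultimately show "(\<Sum>g\<in>colorings N A \<rho>. ?e (add_content (A - {j}) (restrict g (A - {j})) id)) =
          color_weight N \<rho> j * psum N ?B (?\<rho> j) ?e id"
        using sum_colorings_delete[OF \<rho> j A(1), of "\<lambda>g. ?e (add_content (A - {j}) g id)" N]
        by (simp add: psum_def color_weight_def)
    qed
    finally show ?thesis .
  qed
  have \<tau>B: "\<tau> ` ?B \<subseteq> ?B" using \<tau> permutes_in_image[OF \<tau>(1)] injD[OF permutes_inj[OF \<tau>(1)], of _ m] by auto
  have single: "psum N {m} \<tau> E \<gamma> = (\<Sum>c<N. E (raise 1 c \<gamma>))" for E \<gamma>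
  proof -
    have "(\<lambda>_. m) ` {..<1 :: nat} = {m}" by auto
    then show ?thesis using psum_cycle[of 1 "\<lambda>_. m" \<tau> N E \<gamma>] \<tau>(2) by (simp add: inj_on_def)
  qed
  have Am: "A = ?B \<union> {m}" using A(2) by auto
  have "psum_pairing N A \<tau> \<rho> = psum N ?B \<tau> (psum N {m} \<tau> (\<lambda>\<gamma>. psum N A \<rho> (pairing N \<gamma>) id)) id"
    unfolding psum_pairing_def by (subst Am, rule psum_union) (use A \<tau> \<tau>B in auto)
  also have "\<dots> = psum N ?B \<tau> (\<lambda>\<gamma>. \<Sum>j\<in>A. color_weight N \<rho> j * psum N ?B (?\<rho> j) (pairing N \<gamma>) id) id"
    unfolding single adjoint ..
  also have "\<dots> = (\<Sum>j\<in>A. color_weight N \<rho> j * psum_pairing N ?B \<tau> (?\<rho> j))"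
    unfolding psum_pairing_def psum_def[of N ?B \<tau>] sum_distrib_left by (rule sum.swap)
  finally show ?thesis .
qed

text \<open>The recursion of the pairing holds for the sum over conjugates as well: group the \<open>\<sigma>\<close> by
  \<open>j = \<sigma> m\<close>. Then \<open>j\<close> is a fixed point of \<open>\<sigma> \<circ> \<tau> \<circ> inv \<sigma>\<close>, and deleting it from \<open>\<rho>\<close> does not change the
  cycles of the product apart from the loss of a cycle \<open>{j}\<close> when \<open>j\<close> is fixed by \<open>\<rho>\<close>.\<close>

lemma conj_sum_fixpoint:
  assumes \<tau>: "\<tau> permutes A" "\<tau> m = m" and \<rho>: "\<rho> permutes A" and A: "finite A" "m \<in> A"
  shows "conj_sum N A \<tau> \<rho> = (\<Sum>j\<in>A. color_weight N \<rho> j *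
    conj_sum N (A - {m}) \<tau> (delete m (transpose j m \<circ> \<rho> \<circ> transpose j m)))"
proof -
  let ?B = "A - {m}"
  let ?\<rho> = "\<lambda>j. transpose j m \<circ> \<rho> \<circ> transpose j m"
  let ?K = "\<lambda>\<pi>. real (card (colorings N A \<pi>))"
  have "conj_sum N A \<tau> \<rho> = (\<Sum>\<sigma> | \<sigma> permutes insert m ?B. ?K (\<sigma> \<circ> \<tau> \<circ> inv \<sigma> \<circ> \<rho>))"
    using A by (simp add: conj_sum_def insert_absorb)
  also have "\<dots> = (\<Sum>j\<in>insert m ?B. \<Sum>q | q permutes ?B. ?K (transpose m j \<circ> q \<circ> \<tau> \<circ> inv (transpose m j \<circ> q) \<circ> \<rho>))"
    by (rule sum_over_permutations_insert) (use A in auto)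
  also have "insert m ?B = A" using A by auto
  also have "(\<Sum>j\<in>A. \<Sum>q | q permutes ?B. ?K (transpose m j \<circ> q \<circ> \<tau> \<circ> inv (transpose m j \<circ> q) \<circ> \<rho>)) =
    (\<Sum>j\<in>A. \<Sum>q | q permutes ?B. color_weight N \<rho> j *
      real (card (colorings N ?B (q \<circ> \<tau> \<circ> inv q \<circ> delete m (?\<rho> j)))))"
  proof (intro sum.cong refl)
    fix j q assume j: "j \<in> A" and "q \<in> {q. q permutes ?B}"
    then have q: "q permutes ?B" by simp
    let ?t = "transpose j m"
    let ?\<pi> = "q \<circ> \<tau> \<circ> inv q"
    have qm: "q m = m" using q by (simp add: permutes_not_in)
    have qA: "q permutes A" using q by (rule permutes_subset) auto
    have \<pi>: "?\<pi> permutes A" using qA \<tau> by (auto intro!: permutes_compose permutes_inv)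
    have "inv q m = m" using qm permutes_inverses(2)[OF q, of m] by simp
    then have \<pi>m: "?\<pi> m = m" using qm \<tau> by simp
    have \<rho>j: "?\<rho> j permutes A" using \<rho> j A by (intro transpose_conj_permutes)
    have all: "?\<pi> \<circ> ?\<rho> j permutes A" using \<rho>j \<pi> by (rule permutes_compose)
    have "transpose m j \<circ> q \<circ> \<tau> \<circ> inv (transpose m j \<circ> q) \<circ> \<rho> = ?t \<circ> ?\<pi> \<circ> ?t \<circ> \<rho>"
      using o_inv_distrib[OF bij_transpose permutes_bij[OF q], of m j]
      by (simp add: comp_assoc transpose_commute)
    also have "\<dots> = ?t \<circ> (?\<pi> \<circ> ?\<rho> j) \<circ> inv ?t"
      by (simp add: comp_assoc)
    finally have "?K (transpose m j \<circ> q \<circ> \<tau> \<circ> inv (transpose m j \<circ> q) \<circ> \<rho>) = ?K (?t \<circ> (?\<pi> \<circ> ?\<rho> j) \<circ> inv ?t)"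
      by simp
    also have "\<dots> = ?K (?\<pi> \<circ> ?\<rho> j)"
    proof -
      have "bij_betw (\<lambda>f. restrict (f \<circ> ?t) A) (colorings N A (?t \<circ> (?\<pi> \<circ> ?\<rho> j) \<circ> inv ?t)) (colorings N A (?\<pi> \<circ> ?\<rho> j))"
        by (rule bij_betw_colorings_conj)
          (use all j A(2) in \<open>auto simp: permutes_in_image[OF all, simplified]\<close>)
      then show ?thesis by (simp add: bij_betw_same_card)
    qed
    also have "\<dots> = (if (?\<pi> \<circ> ?\<rho> j) m = m then real N else 1) * real (card (colorings N ?B (delete m (?\<pi> \<circ> ?\<rho> j))))"
      using sum_colorings_delete[OF all A(2,1), of "\<lambda>_. 1" N] by simp
    also have "delete m (?\<pi> \<circ> ?\<rho> j) = ?\<pi> \<circ> delete m (?\<rho> j)"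
    proof -
      have "transpose m (?\<pi> b) (?\<pi> a) = ?\<pi> (transpose m b a)" for a b
        using transpose_apply_commute[OF permutes_bij[OF \<pi>], of m "?\<pi> b" a] \<pi>m permutes_inverses(2)[OF \<pi>]
        by metis
      then show ?thesis by (simp add: delete_def fun_eq_iff)
    qed
    also have "(?\<pi> \<circ> ?\<rho> j) m = m \<longleftrightarrow> \<rho> j = j"
    proof -
      have "(?\<pi> \<circ> ?\<rho> j) m = m \<longleftrightarrow> ?\<rho> j m = m"
        using \<pi>m injD[OF permutes_inj[OF \<pi>], of "?\<rho> j m" m] by auto
      also have "\<dots> \<longleftrightarrow> \<rho> j = j" by (auto simp: transpose_eq_iff)
      finally show ?thesis .
    qed
    finally show "?K (transpose m j \<circ> q \<circ> \<tau> \<circ> inv (transpose m j \<circ> q) \<circ> \<rho>) = color_weight N \<rho> j *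
      real (card (colorings N ?B (q \<circ> \<tau> \<circ> inv q \<circ> delete m (?\<rho> j))))"
      by (simp only: color_weight_def)
  qed
  finally show ?thesis by (simp add: conj_sum_def sum_distrib_left)
qed

lemma orbit_subset_invariant:
  assumes "\<pi> ` S \<subseteq> S" "x \<in> S"
  shows "orbit \<pi> x \<subseteq> S"
proof
  fix y assume "y \<in> orbit \<pi> x"
  then show "y \<in> S" using assms by induction auto
qed

text \<open>Induction on the size of an invariant set \<open>C\<close>. Cut a point \<open>m\<close> out of its cycle to
  obtain \<open>\<kappa>\<close>, and let \<open>D\<close> be the rest of that cycle. Among the products of \<open>\<kappa>\<close> with transpositions
  those that leave \<open>m\<close> fixed do not count. Inserting \<open>m\<close> back into \<open>D\<close>, at whatever place, gives a
  conjugate of \<open>\<tau>\<close>; inserting it elsewhere leaves \<open>D\<close> as a smaller invariant set. So the vanishing sum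
  is a positive multiple of the value at \<open>\<tau>\<close>.\<close>

lemma vanish_by_transpositions:
  fixes \<Phi> :: "('a \<Rightarrow> 'a) \<Rightarrow> real"
  assumes fin: "finite A"
    and conj: "\<And>g \<tau>. g permutes A \<Longrightarrow> \<tau> permutes A \<Longrightarrow> \<Phi> (g \<circ> \<tau> \<circ> inv g) = \<Phi> \<tau>"
    and fixpoint: "\<And>\<tau> m. \<tau> permutes A \<Longrightarrow> m \<in> A \<Longrightarrow> \<tau> m = m \<Longrightarrow> \<Phi> \<tau> = 0"
    and transp: "\<And>\<tau> m. \<tau> permutes A \<Longrightarrow> m \<in> A \<Longrightarrow> \<tau> m = m \<Longrightarrow> (\<Sum>i\<in>A. \<Sum>j\<in>A. \<Phi> (transpose i j \<circ> \<tau>)) = 0"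
    and \<tau>: "\<tau> permutes A" and C: "C \<subseteq> A" "C \<noteq> {}" "\<tau> ` C \<subseteq> C"
  shows "\<Phi> \<tau> = 0"
  using \<tau> C
proof (induction "card C" arbitrary: \<tau> C rule: less_induct)
  case less
  note \<tau> = \<open>\<tau> permutes A\<close>
  obtain m where m: "m \<in> C" "m \<in> A" using less.prems by auto
  show ?case
  proof (cases "\<tau> m = m")
    case True then show ?thesis using fixpoint \<tau> m by blast
  next
    case False
    define \<kappa> where "\<kappa> = delete m \<tau>"
    define D where "D = orbit \<kappa> (\<tau> m)"
    let ?B = "A - {m}"
    have \<kappa>B: "\<kappa> permutes ?B" unfolding \<kappa>_def using \<tau> m(2) by (rule delete_permutes)
    then have \<kappa>: "\<kappa> permutes A" by (rule permutes_subset) auto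
    have \<kappa>m: "\<kappa> m = m" by (simp add: \<kappa>_def delete_def)
    have \<tau>m: "\<tau> m \<in> C - {m}" using False m less.prems by auto
    have "\<kappa> ` (C - {m}) \<subseteq> C - {m}"
    proof (rule image_subsetI)
      fix a assume "a \<in> C - {m}"
      then show "\<kappa> a \<in> C - {m}"
        using delete_apply[OF \<tau>, of a m] less.prems m False by (auto simp: \<kappa>_def)
    qed
    then have DC: "D \<subseteq> C - {m}" unfolding D_def using \<tau>m by (rule orbit_subset_invariant)
    have finC: "finite C" using less.prems(2) fin by (rule finite_subset)
    have mD: "m \<notin> D" using DC by auto
    have D0: "\<tau> m \<in> D" unfolding D_def
      by (rule permutation_self_in_orbit) (use \<kappa> fin in \<open>auto simp: permutation_permutes\<close>)
    have cardD: "card D < card C"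
      using DC finC m(1) by (intro psubset_card_mono) auto
    have \<kappa>D: "\<kappa> ` D \<subseteq> D" unfolding D_def by (auto intro: orbit.step)
    have \<tau>_eq: "transpose m (\<tau> m) \<circ> \<kappa> = \<tau>"
      by (simp add: \<kappa>_def delete_def fun_eq_iff)
    have permt: "transpose i j \<circ> \<kappa> permutes A" if "i \<in> A" "j \<in> A" for i j
      using that \<kappa> by (intro permutes_compose permutes_swap_id)
    have away: "\<Phi> (transpose i j \<circ> \<kappa>) = 0" if "i \<in> ?B" "j \<in> ?B" for i j
      by (rule fixpoint[of _ m]) (use that permt \<kappa>m m in auto)
    have outside: "\<Phi> (transpose m j \<circ> \<kappa>) = 0" if "j \<in> ?B - D" for j
    proof (rule less.hyps[OF cardD])
      show "transpose m j \<circ> \<kappa> permutes A" using that m permt by auto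
      show "D \<subseteq> A" "D \<noteq> {}" using DC less.prems D0 by auto
      show "(transpose m j \<circ> \<kappa>) ` D \<subseteq> D"
      proof (clarify)
        fix a assume "a \<in> D"
        then have "\<kappa> a \<in> D" using \<kappa>D by auto
        moreover have "\<kappa> a \<noteq> m" "\<kappa> a \<noteq> j" using \<open>\<kappa> a \<in> D\<close> mD that by auto
        ultimately show "(transpose m j \<circ> \<kappa>) a \<in> D" by simp
      qed
    qed
    have inside: "\<Phi> (transpose m j \<circ> \<kappa>) = \<Phi> \<tau>" if "j \<in> D" for j
    proof -
      obtain r where r: "j = (\<kappa> ^^ r) (\<tau> m)"
        using \<open>j \<in> D\<close> orbit_altdef[of \<kappa> "\<tau> m"] unfolding D_def by auto
      let ?g = "\<kappa> ^^ r"
      have g: "?g permutes A" using \<kappa> by (rule permutes_funpow)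
      have gm: "?g m = m" using \<kappa>m by (induction r) auto
      have comm: "?g (\<kappa> a) = \<kappa> (?g a)" for a by (simp add: funpow_swap1)
      have "?g (transpose m (\<tau> m) b) = transpose m j (?g b)" for b
        using transpose_apply_commute[OF permutes_bij[OF g], of m j b] permutes_inverses(2)[OF g] gm r by metis
      then have "?g \<circ> (transpose m (\<tau> m) \<circ> \<kappa>) = transpose m j \<circ> \<kappa> \<circ> ?g"
        using comm by (simp add: fun_eq_iff)
      then have "?g \<circ> \<tau> \<circ> inv ?g = transpose m j \<circ> \<kappa>"
        unfolding \<tau>_eq using permutes_inv_o(1)[OF g] by (simp add: comp_assoc)
      then show ?thesis using conj[OF g \<tau>] by simp
    qed
    have split: "(\<Sum>j\<in>A. h j) = h m + (\<Sum>j\<in>?B. h j)" for h :: "'a \<Rightarrow> real"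
      using fin m(2) by (rule sum.remove)
    have mm: "\<Phi> (transpose m m \<circ> \<kappa>) = 0"
      using fixpoint[OF \<kappa> m(2) \<kappa>m] by simp
    have "0 = (\<Sum>i\<in>A. \<Sum>j\<in>A. \<Phi> (transpose i j \<circ> \<kappa>))"
      using transp[OF \<kappa> m(2) \<kappa>m] by simp
    also have "\<dots> = (\<Sum>j\<in>?B. \<Phi> (transpose m j \<circ> \<kappa>)) + (\<Sum>i\<in>?B. \<Phi> (transpose i m \<circ> \<kappa>))"
      unfolding split mm using away by (simp add: sum.distrib)
    also have "(\<Sum>i\<in>?B. \<Phi> (transpose i m \<circ> \<kappa>)) = (\<Sum>j\<in>?B. \<Phi> (transpose m j \<circ> \<kappa>))"
      by (simp only: transpose_commute[of _ m])
    finally have "0 = (\<Sum>j\<in>?B. \<Phi> (transpose m j \<circ> \<kappa>)) + (\<Sum>j\<in>?B. \<Phi> (transpose m j \<circ> \<kappa>))" .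
    then have "0 = (\<Sum>j\<in>?B. \<Phi> (transpose m j \<circ> \<kappa>))" by linarith
    also have "\<dots> = (\<Sum>j\<in>D. \<Phi> (transpose m j \<circ> \<kappa>))"
      by (rule sum.mono_neutral_right) (use fin DC less.prems outside in auto)
    also have "\<dots> = real (card D) * \<Phi> \<tau>" using inside by simp
    finally show ?thesis
      using D0 finite_subset[OF DC] finC by auto
  qed
qed

text \<open>Both sides obey the same recursion at fixed points of \<open>\<tau>\<close> and the same exchange rule for
  transpositions, and these two properties leave no freedom for their difference.\<close>

theorem conj_sum_eq_psum_pairing:
  assumes "finite A" "\<tau> permutes A" "\<rho> permutes A"
  shows "conj_sum N A \<tau> \<rho> * pairing N id id = psum_pairing N A \<tau> \<rho>"
  using assms
proof (induction A arbitrary: \<tau> \<rho> rule: finite_psubset_induct)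
  case (psubset A)
  show ?case
  proof (cases "A = {}")
    case True
    have "add_content {} f id = id" for f :: "'a \<Rightarrow> nat" by (auto simp: add_content_def)
    then show ?thesis using psubset.prems True
      by (simp add: conj_sum_def psum_pairing_def psum_def colorings_def id_def)
  next
    case False
    note \<rho> = \<open>\<rho> permutes A\<close>
    have fixpoint: "conj_sum N A \<kappa> \<rho> * pairing N id id = psum_pairing N A \<kappa> \<rho>"
      if \<kappa>: "\<kappa> permutes A" "\<kappa> m = m" and m: "m \<in> A" and \<rho>: "\<rho> permutes A" for \<kappa> \<rho> m
    proof -
      have "\<kappa> permutes A - {m}" using \<kappa> by (auto intro: permutes_superset)
      moreover have "delete m (transpose j m \<circ> \<rho> \<circ> transpose j m) permutes A - {m}" if "j \<in> A" for j
        using transpose_conj_permutes[OF \<rho> that m] m by (rule delete_permutes)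
      ultimately have "conj_sum N (A - {m}) \<kappa> (delete m (transpose j m \<circ> \<rho> \<circ> transpose j m)) * pairing N id id =
          psum_pairing N (A - {m}) \<kappa> (delete m (transpose j m \<circ> \<rho> \<circ> transpose j m))" if "j \<in> A" for j
        using that m by (intro psubset.IH) auto
      then show ?thesis
        unfolding conj_sum_fixpoint[OF \<kappa> \<rho> psubset.hyps(1) m] psum_pairing_fixpoint[OF \<kappa> \<rho> psubset.hyps(1) m]
        by (simp add: sum_distrib_right mult.assoc)
    qed
    define \<Phi> where "\<Phi> \<kappa> = conj_sum N A \<kappa> \<rho> * pairing N id id - psum_pairing N A \<kappa> \<rho>" for \<kappa>
    have "\<Phi> \<tau> = 0"
    proof (rule vanish_by_transpositions[where \<Phi> = \<Phi> and C = A])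
      show "\<Phi> (g \<circ> \<kappa> \<circ> inv g) = \<Phi> \<kappa>" if "g permutes A" "\<kappa> permutes A" for g \<kappa>
        using that by (simp add: \<Phi>_def conj_sum_conj psum_pairing_conj)
      show "\<Phi> \<kappa> = 0" if "\<kappa> permutes A" "m \<in> A" "\<kappa> m = m" for \<kappa> m
        using fixpoint[OF that(1,3,2) \<rho>] by (simp add: \<Phi>_def)
      show "(\<Sum>i\<in>A. \<Sum>j\<in>A. \<Phi> (transpose i j \<circ> \<kappa>)) = 0" if \<kappa>: "\<kappa> permutes A" "m \<in> A" "\<kappa> m = m" for \<kappa> m
      proof -
        have "(\<Sum>i\<in>A. \<Sum>j\<in>A. \<Phi> (transpose i j \<circ> \<kappa>)) =
          (\<Sum>i\<in>A. \<Sum>j\<in>A. conj_sum N A (transpose i j \<circ> \<kappa>) \<rho>) * pairing N id id -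
          (\<Sum>i\<in>A. \<Sum>j\<in>A. psum_pairing N A (transpose i j \<circ> \<kappa>) \<rho>)"
          by (simp add: \<Phi>_def sum_subtractf sum_distrib_right)
        also have "\<dots> = (\<Sum>i\<in>A. \<Sum>j\<in>A. conj_sum N A \<kappa> (transpose i j \<circ> \<rho>) * pairing N id id -
            psum_pairing N A \<kappa> (transpose i j \<circ> \<rho>))"
          unfolding conj_sum_transpositions[OF \<kappa>(1) \<rho> psubset.hyps(1)]
            psum_pairing_transpositions[OF \<kappa>(1) \<rho> psubset.hyps(1)]
          by (simp add: sum_subtractf sum_distrib_right)
        also have "\<dots> = 0"
        proof (intro sum.neutral ballI)
          fix i j assume "i \<in> A" "j \<in> A"
          then have "transpose i j \<circ> \<rho> permutes A" using \<rho> by (intro permutes_compose permutes_swap_id)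
          then show "conj_sum N A \<kappa> (transpose i j \<circ> \<rho>) * pairing N id id -
            psum_pairing N A \<kappa> (transpose i j \<circ> \<rho>) = 0"
            using fixpoint[OF \<kappa>(1,3,2)] by simp
        qed
        finally show ?thesis .
      qed
    qed (use psubset False permutes_image[of \<tau> A] in auto)
    then show ?thesis unfolding \<Phi>_def by linarith
  qed
qed

section \<open>Two cycles of equal length\<close>

lemma cycle_of_list_upt:
  assumes "i < M"
  shows "cycle_of_list [a..<a + M] (a + i) = a + Suc i mod M"
proof -
  let ?cs = "[a..<a + M]"
  have "map (cycle_of_list ?cs) ?cs = rotate1 ?cs"
    using cyclic_rotation[of ?cs 1] by simp
  then have "map (cycle_of_list ?cs) ?cs ! i = rotate1 ?cs ! i" by simp
  then show ?thesis using assms by (simp add: nth_rotate1)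
qed

lemma two_cycles_first: "i < M \<Longrightarrow> two_cycles M (1 + i) = 1 + Suc i mod M"
  using cycle_of_list_upt[of i M 1] id_outside_supp[of "1 + i" "[M + 1..<2 * M + 1]"]
  by (simp add: two_cycles_def)

lemma two_cycles_second: "i < M \<Longrightarrow> two_cycles M (M + 1 + i) = M + 1 + Suc i mod M"
  using cycle_of_list_upt[of i M "M + 1"] id_outside_supp[of "M + 1 + Suc i mod M" "[1..<M + 1]"]
  by (simp add: two_cycles_def mult_2)

lemma two_cycles_permutes: "two_cycles M permutes {1..2 * M}"
proof -
  have "cycle_of_list [1..<M + 1] permutes {1..2 * M}"
    by (rule permutes_subset[OF cycle_permutes]) auto
  moreover have "cycle_of_list [M + 1..<2 * M + 1] permutes {1..2 * M}"
    by (rule permutes_subset[OF cycle_permutes]) auto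
  ultimately show ?thesis unfolding two_cycles_def by (intro permutes_compose)
qed

lemma psum_two_cycles:
  assumes "M \<ge> 1"
  shows "psum N {1..2 * M} (two_cycles M) e \<gamma> = (\<Sum>c<N. \<Sum>c'<N. e (raise M c (raise M c' \<gamma>)))"
proof -
  let ?y = "\<lambda>i. 1 + i" and ?z = "\<lambda>i. M + 1 + i"
  have img: "?y ` {..<M} = {1..M}" "?z ` {..<M} = {M + 1..2 * M}"
    unfolding lessThan_atLeast0 image_add_atLeastLessThan by auto
  have 1: "psum N {1..M} (two_cycles M) e \<gamma> = (\<Sum>c<N. e (raise M c \<gamma>))" for e \<gamma>
    unfolding img(1)[symmetric]
    by (rule psum_cycle) (use assms two_cycles_first[of _ M] two_cycles_first[of "M - 1" M] in auto)
  have 2: "psum N {M + 1..2 * M} (two_cycles M) e \<gamma> = (\<Sum>c<N. e (raise M c \<gamma>))" for e \<gamma>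
    unfolding img(2)[symmetric]
    by (rule psum_cycle) (use assms two_cycles_second[of _ M] two_cycles_second[of "M - 1" M] in auto)
  have "two_cycles M ` ?y ` {..<M} \<subseteq> ?y ` {..<M}" "two_cycles M ` ?z ` {..<M} \<subseteq> ?z ` {..<M}"
    using assms two_cycles_first[of _ M] two_cycles_second[of _ M] by (auto simp: image_iff)
  then have inv: "two_cycles M ` {1..M} \<subseteq> {1..M}" "two_cycles M ` {M + 1..2 * M} \<subseteq> {M + 1..2 * M}"
    unfolding img by auto
  have "{1..2 * M} = {1..M} \<union> {M + 1..2 * M}" by auto
  then have "psum N {1..2 * M} (two_cycles M) e \<gamma> =
      psum N {1..M} (two_cycles M) (psum N {M + 1..2 * M} (two_cycles M) e) \<gamma>"
    using psum_union[OF _ _ _ inv, of N e \<gamma>] by auto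
  then show ?thesis unfolding 1 2 by (simp add: raise_commute)
qed

text \<open>For \<open>k > 0\<close>, raising the entry \<open>c\<close> of \<open>id\<close> by \<open>k\<close> leads to a value that is not yet present, and so to a nonzero
  alternant, exactly for these \<open>c\<close>.\<close>

definition top_slots :: "nat \<Rightarrow> nat \<Rightarrow> nat set" where
  "top_slots N k = {c. c < N \<and> N \<le> c + k}"

lemma finite_top_slots [simp]: "finite (top_slots N k)"
  by (rule finite_subset[of _ "{..<N}"]) (auto simp: top_slots_def)

text \<open>The square of the \<open>M\<close>-th power sum, times the Vandermonde determinant, in terms of pairwise
  different alternants. A position \<open>c\<close> raised twice gives the first sum. Two positions \<open>c \<noteq> c'\<close> that are
  both raised beyond \<open>N\<close> give the second one. If \<open>c + M < N\<close>, the raised entry \<open>c\<close> collides with the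
  entry at \<open>c + M\<close>, unless that one is raised too; this last case is the alternant of \<open>c\<close> raised by
  \<open>2 * M\<close> with two entries exchanged. It occurs for two ordered pairs and turns the coefficient
  \<open>1\<close> into \<open>1 - 2 = - 1\<close>.\<close>

lemma sum_raise_pairs:
  assumes e: "alternating N e" and M: "M \<ge> 1"
  shows "(\<Sum>c<N. \<Sum>c'<N. e (raise M c (raise M c' id))) =
    (\<Sum>c\<in>top_slots N (2 * M). (if c + M < N then - 1 else 1) * e (raise (2 * M) c id)) +
    (\<Sum>c\<in>top_slots N M. \<Sum>c'\<in>top_slots N M - {c}. e (raise M c (raise M c' id)))"
proof -
  let ?E = "\<lambda>c c'. e (raise M c (raise M c' id))" and ?a = "\<lambda>c. e (raise (2 * M) c id)"
  let ?T = "top_slots N M"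
  have hop: "?E c (c + M) = - ?a c" if "c + M < N" for c
  proof -
    have "raise M c (raise M (c + M) id) = raise (2 * M) c id \<circ> transpose c (c + M)"
      using M by (auto simp: raise_def fun_eq_iff Transposition.transpose_def)
    then show ?thesis using alternating_swap[OF e, of c "c + M" "raise (2 * M) c id"] that M by simp
  qed
  have blocked: "?E c c' = 0" if "c < N" "c' < N" "c \<noteq> c'" "c + M < N" "c' \<noteq> c + M" for c c'
    by (rule alternating_zero[OF e, of c "c + M"]) (use that M in \<open>auto simp: raise_def\<close>)
  have pt: "?E c c' = (if c = c' then ?a c else 0) + (if c \<in> ?T \<and> c' \<in> ?T - {c} then ?E c c' else 0)
      - (if c' = c + M then ?a c else 0) - (if c = c' + M then ?a c' else 0)"
    if cN: "c < N" "c' < N" for c c'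
  proof -
    consider "c = c'" | "c' = c + M" | "c = c' + M" | "c \<noteq> c'" "c' \<noteq> c + M" "c \<noteq> c' + M" by blast
    then show ?thesis
    proof cases
      case 1
      then show ?thesis using M by (simp add: raise_raise mult_2)
    next
      case 2
      then show ?thesis using hop[of c] M cN by (auto simp: top_slots_def)
    next
      case 3
      then show ?thesis using hop[of c'] M cN raise_commute[of M c M c' id] by (auto simp: top_slots_def)
    next
      case 4
      then show ?thesis
        using blocked[of c c'] blocked[of c' c] cN raise_commute[of M c M c' id] by (auto simp: top_slots_def)
    qed
  qed
  have T: "?T \<subseteq> {..<N}" by (auto simp: top_slots_def)
  have both: "(\<Sum>c<N. \<Sum>c'<N. if c \<in> ?T \<and> c' \<in> ?T - {c} then ?E c c' else 0) = (\<Sum>c\<in>?T. \<Sum>c'\<in>?T - {c}. ?E c c')"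
  proof -
    have "(\<Sum>c'<N. if c \<in> ?T \<and> c' \<in> ?T - {c} then ?E c c' else 0) = (if c \<in> ?T then \<Sum>c'\<in>?T - {c}. ?E c c' else 0)" for c
    proof (cases "c \<in> ?T")
      case True
      have "{..<N} \<inter> (?T - {c}) = ?T - {c}" using T by auto
      then show ?thesis using True sum.inter_restrict[of "{..<N}" "?E c" "?T - {c}"] by simp
    qed simp
    moreover have "{..<N} \<inter> ?T = ?T" using T by auto
    ultimately show ?thesis
      using sum.inter_restrict[of "{..<N}" "\<lambda>c. \<Sum>c'\<in>?T - {c}. ?E c c'" ?T] by simp
  qed
  have hops: "(\<Sum>c<N. \<Sum>c'<N. if c' = c + M then ?a c else 0) = (\<Sum>c<N. if c + M < N then ?a c else 0)"
    by (intro sum.cong refl) simp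
  moreover have "(\<Sum>c<N. \<Sum>c'<N. if c = c' + M then ?a c' else 0) = (\<Sum>c<N. \<Sum>c'<N. if c' = c + M then ?a c else 0)"
    by (rule sum.swap)
  moreover have "(\<Sum>c<N. \<Sum>c'<N. ?E c c') = (\<Sum>c<N. \<Sum>c'<N.
      (if c = c' then ?a c else 0) + (if c \<in> ?T \<and> c' \<in> ?T - {c} then ?E c c' else 0)
      - (if c' = c + M then ?a c else 0) - (if c = c' + M then ?a c' else 0))"
    by (intro sum.cong refl pt) auto
  ultimately have "(\<Sum>c<N. \<Sum>c'<N. ?E c c') = (\<Sum>c<N. ?a c) + (\<Sum>c\<in>?T. \<Sum>c'\<in>?T - {c}. ?E c c')
      - 2 * (\<Sum>c<N. if c + M < N then ?a c else 0)"
    using both by (simp add: sum.distrib sum_subtractf)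
  also have "\<dots> = (\<Sum>c<N. (if c + M < N then - 1 else 1) * ?a c) + (\<Sum>c\<in>?T. \<Sum>c'\<in>?T - {c}. ?E c c')"
  proof -
    have "(\<Sum>c<N. (if c + M < N then - 1 else 1) * ?a c) = (\<Sum>c<N. ?a c - 2 * (if c + M < N then ?a c else 0))"
      by (intro sum.cong) auto
    then show ?thesis by (simp add: sum_subtractf sum_distrib_left)
  qed
  also have "(\<Sum>c<N. (if c + M < N then - 1 else 1) * ?a c) =
    (\<Sum>c\<in>top_slots N (2 * M). (if c + M < N then - 1 else 1) * ?a c)"
  proof (rule sum.mono_neutral_right)
    show "\<forall>c\<in>{..<N} - top_slots N (2 * M). (if c + M < N then - 1 else 1) * ?a c = 0"
    proof
      fix c assume c: "c \<in> {..<N} - top_slots N (2 * M)"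
      have "?a c = 0"
        by (rule alternating_zero[OF e, of c "c + 2 * M"]) (use c M in \<open>auto simp: top_slots_def raise_def\<close>)
      then show "(if c + M < N then - 1 else 1) * ?a c = 0" by simp
    qed
  qed (auto simp: top_slots_def)
  finally show ?thesis .
qed

lemma pairing_image:
  assumes "pairing N \<gamma> \<gamma>' \<noteq> 0"
  shows "\<gamma>' ` {..<N} = \<gamma> ` {..<N}"
proof (rule ccontr)
  assume *: "\<gamma>' ` {..<N} \<noteq> \<gamma> ` {..<N}"
  have "\<gamma>' \<noteq> \<gamma> \<circ> u" if "u permutes {..<N}" for u
    using * permutes_image[OF that] by (metis image_comp)
  then have "pairing N \<gamma> \<gamma>' = 0" unfolding pairing_def by (intro sum.neutral) auto
  then show False using assms by simp
qed

lemma pairing_self: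
  assumes "inj_on \<gamma> {..<N}"
  shows "pairing N \<gamma> \<gamma> = (\<Prod>i<N. fact (\<gamma> i))"
proof -
  have "u = id" if u: "u permutes {..<N}" "\<gamma> = \<gamma> \<circ> u" for u
  proof
    fix i show "u i = id i"
    proof (cases "i < N")
      case True
      then have "u i \<in> {..<N}" using permutes_in_image[OF u(1), of i] by simp
      then show ?thesis using True inj_onD[OF assms, of "u i" i] fun_cong[OF u(2), of i] by simp
    next
      case False then show ?thesis using permutes_not_in[OF u(1), of i] by simp
    qed
  qed
  then have "pairing N \<gamma> \<gamma> = (\<Sum>u | u permutes {..<N}. if u = id then (\<Prod>i<N. fact (\<gamma> i)) else 0)"
    unfolding pairing_def by (intro sum.cong) auto
  then show ?thesis by (simp add: finite_permutations permutes_id)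
qed

lemma pairing_id: "pairing N id id = (\<Prod>i<N. fact i)"
  by (simp add: pairing_self)

lemma prod_fact_raise:
  assumes "c < N"
  shows "(\<Prod>i<N. fact (raise k c \<gamma> i)) = pochhammer (real (\<gamma> c) + 1) k * (\<Prod>i<N. fact (\<gamma> i))"
proof -
  have "fact (n + k) = fact n * pochhammer (real n + 1) k" for n
    using pochhammer_product'[of "1 :: real" n k] by (simp add: pochhammer_fact[symmetric] add.commute[of 1])
  then have "(\<Prod>i<N. fact (raise k c \<gamma> i)) =
    (\<Prod>i<N. fact (\<gamma> i) * (if i = c then pochhammer (real (\<gamma> c) + 1) k else 1))"
    by (intro prod.cong) (auto simp: raise_def)
  then show ?thesis using assms by (simp add: prod.distrib)
qed

text \<open>Alternants with different sets of exponents are orthogonal, and the entries of \<open>id\<close> that are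
  missing after raising tell which positions were raised.\<close>

lemma pairing_raise_raise:
  assumes "c \<in> top_slots N k" "d \<in> top_slots N k"
  shows "pairing N (raise k c id) (raise k d id) =
    (if c = d then pochhammer (real c + 1) k * pairing N id id else 0)"
proof -
  have img: "{..<N} - raise k c id ` {..<N} = {c}" if "c \<in> top_slots N k" for c
    using that by (auto simp: raise_def top_slots_def image_iff)
  have inj: "inj_on (raise k c id) {..<N}"
    using assms by (auto simp: inj_on_def raise_def top_slots_def)
  show ?thesis
  proof (cases "c = d")
    case True
    then show ?thesis using pairing_self[OF inj] prod_fact_raise[of c N k id] assms
      by (simp add: pairing_id top_slots_def)
  next
    case False
    have "pairing N (raise k c id) (raise k d id) = 0"
    proof (rule ccontr)
      assume "pairing N (raise k c id) (raise k d id) \<noteq> 0"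
      then have "{c} = {d}" using pairing_image img[OF assms(1)] img[OF assms(2)] by metis
      then show False using False by simp
    qed
    then show ?thesis using False by simp
  qed
qed

lemma pairing_raise_pair_raise:
  assumes "c \<in> top_slots N k" "p \<in> top_slots N l" "q \<in> top_slots N l" "p \<noteq> q"
  shows "pairing N (raise k c id) (raise l p (raise l q id)) = 0"
proof (rule ccontr)
  assume "\<not> ?thesis"
  then have "{..<N} - raise l p (raise l q id) ` {..<N} = {..<N} - raise k c id ` {..<N}"
    by (simp add: pairing_image)
  moreover have "{..<N} - raise k c id ` {..<N} = {c}"
    using assms by (auto simp: raise_def top_slots_def image_iff)
  moreover have "{..<N} - raise l p (raise l q id) ` {..<N} = {p, q}"
    using assms by (auto simp: raise_def top_slots_def image_iff)
  ultimately show False using \<open>p \<noteq> q\<close> by auto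
qed

lemma pairing_pair_raise:
  assumes "p \<in> top_slots N l" "q \<in> top_slots N l" "p \<noteq> q"
    and "r \<in> top_slots N l" "s \<in> top_slots N l" "r \<noteq> s"
  shows "pairing N (raise l p (raise l q id)) (raise l r (raise l s id)) =
    (if (r, s) = (p, q) \<or> (r, s) = (q, p)
     then pochhammer (real p + 1) l * pochhammer (real q + 1) l * pairing N id id else 0)"
proof -
  have img: "{..<N} - raise l p (raise l q id) ` {..<N} = {p, q}"
    if "p \<in> top_slots N l" "q \<in> top_slots N l" "p \<noteq> q" for p q
    using that by (auto simp: raise_def top_slots_def image_iff)
  have inj: "inj_on (raise l p (raise l q id)) {..<N}"
    using assms(1-3) by (auto simp: inj_on_def raise_def top_slots_def)
  have self: "pairing N (raise l p (raise l q id)) (raise l p (raise l q id)) =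
    pochhammer (real p + 1) l * pochhammer (real q + 1) l * pairing N id id"
    using pairing_self[OF inj] prod_fact_raise[of p N l "raise l q id"] prod_fact_raise[of q N l id] assms
    by (simp add: pairing_id top_slots_def) (simp add: raise_def)
  show ?thesis
  proof (cases "{r, s} = {p, q}")
    case True
    then show ?thesis using self raise_commute[of l p l q id] by (auto simp: doubleton_eq_iff)
  next
    case False
    then have "pairing N (raise l p (raise l q id)) (raise l r (raise l s id)) = 0"
      using pairing_image[of N "raise l p (raise l q id)" "raise l r (raise l s id)"] img[OF assms(1-3)] img[OF assms(4-6)]
      by metis
    then show ?thesis using False by (auto simp: doubleton_eq_iff)
  qed
qed

text \<open>The squared norm of the expansion found above. Signs disappear, and each unordered pair of
  positions has coefficient \<open>2\<close>, hence contributes \<open>4\<close>, that is, \<open>2\<close> for each of its two orders.\<close>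

lemma psum_pairing_two_cycles:
  assumes M: "M \<ge> 1"
  shows "psum_pairing N {1..2 * M} (two_cycles M) (inv (two_cycles M)) = pairing N id id *
    ((\<Sum>c\<in>top_slots N (2 * M). pochhammer (real c + 1) (2 * M)) +
     2 * ((\<Sum>c\<in>top_slots N M. pochhammer (real c + 1) M)\<^sup>2 - (\<Sum>c\<in>top_slots N M. (pochhammer (real c + 1) M)\<^sup>2)))"
proof -
  let ?G = "pairing N id id"
  let ?S = "top_slots N (2 * M)" and ?T = "top_slots N M"
  let ?\<epsilon> = "\<lambda>c. if c + M < N then - 1 else (1 :: real)"
  let ?a = "\<lambda>c. raise (2 * M) c id" and ?b = "\<lambda>c c'. raise M c (raise M c' id)"
  let ?s = "\<lambda>c. pochhammer (real c + 1) (2 * M)" and ?r = "\<lambda>c. pochhammer (real c + 1) M"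
  define V where "V e = (\<Sum>c\<in>?S. ?\<epsilon> c * e (?a c)) + (\<Sum>c\<in>?T. \<Sum>c'\<in>?T - {c}. e (?b c c'))" for e :: "(nat \<Rightarrow> nat) \<Rightarrow> real"
  have eval: "psum N {1..2 * M} (two_cycles M) e id = V e" if "alternating N e" for e
    unfolding V_def psum_two_cycles[OF M] by (rule sum_raise_pairs[OF that M])
  have "psum N {1..2 * M} (inv (two_cycles M)) e \<gamma> = psum N {1..2 * M} (two_cycles M) e \<gamma>" for e \<gamma>
    by (simp only: psum_def colorings_inv[OF two_cycles_permutes])
  then have "psum_pairing N {1..2 * M} (two_cycles M) (inv (two_cycles M)) =
      psum N {1..2 * M} (two_cycles M) (\<lambda>\<gamma>. psum N {1..2 * M} (two_cycles M) (pairing N \<gamma>) id) id"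
    by (simp add: psum_pairing_def)
  also have "\<dots> = V (\<lambda>\<gamma>. psum N {1..2 * M} (two_cycles M) (pairing N \<gamma>) id)"
    by (rule eval[OF alternating_psum_pairing])
  also have "\<dots> = V (\<lambda>\<gamma>. V (pairing N \<gamma>))"
    by (simp only: eval[OF alternating_pairing])
  also have "\<dots> = (\<Sum>c\<in>?S. ?\<epsilon> c * (?\<epsilon> c * ?s c * ?G)) + (\<Sum>c\<in>?T. \<Sum>c'\<in>?T - {c}. 2 * (?r c * ?r c') * ?G)"
  proof -
    have "V (pairing N (?a c)) = ?\<epsilon> c * ?s c * ?G" if c: "c \<in> ?S" for c
    proof -
      have "(\<Sum>d\<in>?S. ?\<epsilon> d * pairing N (?a c) (?a d)) = (\<Sum>d\<in>?S. if d = c then ?\<epsilon> c * ?s c * ?G else 0)"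
        using c by (intro sum.cong) (auto simp: pairing_raise_raise)
      then show ?thesis
        using c pairing_raise_pair_raise[OF c, of _ M] by (simp add: V_def)
    qed
    moreover have "V (pairing N (?b c c')) = 2 * (?r c * ?r c') * ?G" if c: "c \<in> ?T" "c' \<in> ?T - {c}" for c c'
    proof -
      have "pairing N (?b c c') (?a d) = 0" if "d \<in> ?S" for d
        using pairing_raise_pair_raise[OF that, of c M c'] c by (simp add: pairing_sym)
      moreover have "(\<Sum>d'\<in>?T - {d}. pairing N (?b c c') (?b d d')) =
          (if d = c then ?r c * ?r c' * ?G else 0) + (if d = c' then ?r c * ?r c' * ?G else 0)" if "d \<in> ?T" for d
      proof -
        have "(\<Sum>d'\<in>?T - {d}. pairing N (?b c c') (?b d d')) =
          (\<Sum>d'\<in>?T - {d}. (if d' = c' then (if d = c then ?r c * ?r c' * ?G else 0) else 0) +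
            (if d' = c then (if d = c' then ?r c * ?r c' * ?G else 0) else 0))"
          using c that by (intro sum.cong refl) (auto simp: pairing_pair_raise)
        then show ?thesis using c by (auto simp: sum.distrib)
      qed
      ultimately show ?thesis using c by (simp add: V_def sum.distrib)
    qed
    ultimately show ?thesis by (simp add: V_def)
  qed
  also have "(\<Sum>c\<in>?S. ?\<epsilon> c * (?\<epsilon> c * ?s c * ?G)) = ?G * (\<Sum>c\<in>?S. ?s c)"
    unfolding sum_distrib_left by (intro sum.cong) auto
  also have "(\<Sum>c\<in>?T. \<Sum>c'\<in>?T - {c}. 2 * (?r c * ?r c') * ?G) =
      2 * ?G * ((\<Sum>c\<in>?T. ?r c)\<^sup>2 - (\<Sum>c\<in>?T. (?r c)\<^sup>2))"
  proof -
    have "(\<Sum>c'\<in>?T - {c}. 2 * (?r c * ?r c') * ?G) = 2 * ?G * (?r c * (\<Sum>c'\<in>?T. ?r c') - (?r c)\<^sup>2)" if "c \<in> ?T" for c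
    proof -
      have "(\<Sum>c'\<in>?T. ?r c') = ?r c + (\<Sum>c'\<in>?T - {c}. ?r c')"
        using that by (intro sum.remove) auto
      moreover have "(\<Sum>c'\<in>?T - {c}. 2 * (?r c * ?r c') * ?G) = 2 * ?G * ?r c * (\<Sum>c'\<in>?T - {c}. ?r c')"
        unfolding sum_distrib_left by (intro sum.cong) auto
      ultimately show ?thesis by (simp add: algebra_simps power2_eq_square)
    qed
    then have "(\<Sum>c\<in>?T. \<Sum>c'\<in>?T - {c}. 2 * (?r c * ?r c') * ?G) = (\<Sum>c\<in>?T. 2 * ?G * (?r c * (\<Sum>c'\<in>?T. ?r c') - (?r c)\<^sup>2))"
      by simp
    also have "\<dots> = 2 * ?G * ((\<Sum>c\<in>?T. ?r c * (\<Sum>c'\<in>?T. ?r c')) - (\<Sum>c\<in>?T. (?r c)\<^sup>2))"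
      unfolding sum_distrib_left[symmetric] sum_subtractf ..
    also have "(\<Sum>c\<in>?T. ?r c * (\<Sum>c'\<in>?T. ?r c')) = (\<Sum>c\<in>?T. ?r c)\<^sup>2"
      unfolding sum_distrib_right[symmetric] power2_eq_square ..
    finally show ?thesis .
  qed
  finally show ?thesis by (simp only: distrib_left mult.assoc mult.left_commute)
qed

lemma conj_sum_two_cycles:
  assumes "M \<ge> 1"
  shows "conj_sum N {1..2 * M} (two_cycles M) (inv (two_cycles M)) =
    (\<Sum>c\<in>top_slots N (2 * M). pochhammer (real c + 1) (2 * M)) +
     2 * ((\<Sum>c\<in>top_slots N M. pochhammer (real c + 1) M)\<^sup>2 - (\<Sum>c\<in>top_slots N M. (pochhammer (real c + 1) M)\<^sup>2))"
proof -
  have "pairing N id id \<noteq> 0" by (simp add: pairing_id)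
  moreover have "conj_sum N {1..2 * M} (two_cycles M) (inv (two_cycles M)) * pairing N id id =
      psum_pairing N {1..2 * M} (two_cycles M) (inv (two_cycles M))"
    by (rule conj_sum_eq_psum_pairing)
      (auto intro: permutes_inv two_cycles_permutes[simplified])
  ultimately show ?thesis
    unfolding psum_pairing_two_cycles[OF assms] by (simp only: mult.commute[of _ "pairing N id id"] mult_cancel_left simp_thms)
qed

section \<open>Telescoping sums of rising factorials\<close>

text \<open>Telescoping from \<open>N\<close> down to \<open>N - k\<close>. If \<open>k > N\<close>, the terms that are missing from the left-hand side
  are values of \<open>h\<close> at nonpositive integers above \<open>- k\<close>.\<close>

lemma sum_top_slots:
  fixes g h :: "real \<Rightarrow> real"
  assumes step: "\<And>x. g x - g (x - 1) = h x" and zero: "\<And>j. j < k \<Longrightarrow> h (- real j) = 0"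
  shows "(\<Sum>c\<in>top_slots N k. h (real c + 1)) = g (real N) - g (real N - real k)"
  using zero
proof (induction k)
  case 0
  have "top_slots N 0 = {}" by (auto simp: top_slots_def)
  then show ?case by simp
next
  case (Suc k)
  have next_step: "g (real N - real k) - g (real N - real (Suc k)) = h (real N - real k)"
    using step[of "real N - real k"] by (simp add: algebra_simps)
  have IH: "(\<Sum>c\<in>top_slots N k. h (real c + 1)) = g (real N) - g (real N - real k)"
    using Suc by simp
  show ?case
  proof (cases "k < N")
    case True
    then have "top_slots N (Suc k) = insert (N - Suc k) (top_slots N k)" "N - Suc k \<notin> top_slots N k"
      by (auto simp: top_slots_def)
    moreover have "real (N - Suc k) + 1 = real N - real k" using True by (simp add: of_nat_diff)
    ultimately show ?thesis using IH next_step by simp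
  next
    case False
    then have "top_slots N (Suc k) = top_slots N k" by (auto simp: top_slots_def)
    moreover have "h (real N - real k) = 0"
      using Suc.prems[of "k - N"] False by (simp add: of_nat_diff)
    ultimately show ?thesis using IH next_step by simp
  qed
qed

lemma pochhammer_difference:
  fixes x :: "'a :: comm_ring_1"
  shows "pochhammer x (n + 1) - pochhammer (x - 1) (n + 1) = of_nat (n + 1) * pochhammer x n"
  using pochhammer_rec[of "x - 1" n] by (simp add: pochhammer_Suc algebra_simps)

lemma F_minus_eq_pochhammer: "F_minus n x = (- 1) ^ n * pochhammer (- x) n"
  by (induction n) (simp_all add: F_minus_def pochhammer_Suc algebra_simps)

lemma sum_top_slots_pochhammer:
  "(\<Sum>c\<in>top_slots N k. pochhammer (real c + 1) k) =
    1 / real (k + 1) * (F_plus (k + 1) (real N) - F_minus (k + 1) (real N))"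
proof -
  have "(\<Sum>c\<in>top_slots N k. pochhammer (real c + 1) k) =
      pochhammer (real N) (k + 1) / real (k + 1) - pochhammer (real N - real k) (k + 1) / real (k + 1)"
  proof (rule sum_top_slots[where g = "\<lambda>x. pochhammer x (k + 1) / real (k + 1)" and h = "\<lambda>x. pochhammer x k"])
    show "pochhammer x (k + 1) / real (k + 1) - pochhammer (x - 1) (k + 1) / real (k + 1) = pochhammer x k" for x :: real
      using pochhammer_difference[of x k] by (simp add: diff_divide_distrib[symmetric] del: of_nat_Suc)
    show "pochhammer (- real j) k = 0" if "j < k" for j
      using that by (rule pochhammer_of_nat_eq_0_lemma)
  qed
  also have "pochhammer (real N - real k) (k + 1) = F_minus (k + 1) (real N)"
    unfolding F_minus_eq_pochhammer using pochhammer_minus'[of "real N" "k + 1"] by simp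
  finally show ?thesis by (simp add: diff_divide_distrib)
qed

text \<open>Expand one of the two factors by the Vandermonde identity for
  \<open>x = - m + (x + m)\<close>, and merge \<open>pochhammer (x + m) (m - k)\<close> with the other factor.\<close>

lemma pochhammer_square:
  fixes x :: real
  shows "(pochhammer x m)\<^sup>2 =
    (\<Sum>k=0..m. (- 1) ^ k * fact k * real (m choose k) ^ 2 * pochhammer x (2 * m - k))"
proof -
  have "pochhammer x m = pochhammer (- real m + (x + real m)) m" by simp
  also have "\<dots> = (\<Sum>k\<le>m. real (m choose k) * pochhammer (- real m) k * pochhammer (x + real m) (m - k))"
    by (rule pochhammer_binomial_sum)
  finally have "(pochhammer x m)\<^sup>2 =
    (\<Sum>k\<le>m. pochhammer x m * (real (m choose k) * pochhammer (- real m) k * pochhammer (x + real m) (m - k)))"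
    unfolding power2_eq_square by (metis sum_distrib_left)
  also have "\<dots> = (\<Sum>k\<le>m. (- 1) ^ k * fact k * real (m choose k) ^ 2 * pochhammer x (2 * m - k))"
  proof (rule sum.cong[OF refl])
    fix k assume "k \<in> {..m}"
    then have k: "k \<le> m" by simp
    have "pochhammer (- real m) k = (- 1) ^ k * (fact k * real (m choose k))"
      using gbinomial_pochhammer[of "real m" k] by (simp add: binomial_gbinomial field_simps flip: power_mult_distrib)
    moreover have "pochhammer x (2 * m - k) = pochhammer x m * pochhammer (x + real m) (m - k)"
      using pochhammer_product'[of x m "m - k"] k by (simp add: mult_2)
    ultimately show "pochhammer x m * (real (m choose k) * pochhammer (- real m) k * pochhammer (x + real m) (m - k)) =
      (- 1) ^ k * fact k * real (m choose k) ^ 2 * pochhammer x (2 * m - k)"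
      by (simp add: power2_eq_square)
  qed
  finally show ?thesis by (simp add: atMost_atLeast0)
qed

text \<open>With \<open>G\<close> a primitive of \<open>h x = (pochhammer x m)\<^sup>2\<close> for the backward difference, the sum telescopes
  to \<open>G N - G (N - m)\<close>. The reflection \<open>h x = h (1 - m - x)\<close> yields \<open>G (N - m) = - G (- N)\<close>.\<close>

lemma sum_top_slots_pochhammer_square:
  "(\<Sum>c\<in>top_slots N m. (pochhammer (real c + 1) m)\<^sup>2) =
    (\<Sum>k=0..m. (- 1) ^ k * (fact k / real (2 * m - k + 1)) * real (m choose k) ^ 2 *
      (F_plus (2 * m - k + 1) (real N) + F_plus (2 * m - k + 1) (- real N)))"
proof -
  define G where "G x = (\<Sum>k=0..m. (- 1) ^ k * (fact k / real (2 * m - k + 1)) * real (m choose k) ^ 2 *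
    pochhammer x (2 * m - k + 1))" for x :: real
  have step: "G x - G (x - 1) = (pochhammer x m)\<^sup>2" for x
    unfolding pochhammer_square G_def sum_subtractf[symmetric]
  proof (rule sum.cong[OF refl])
    fix k
    let ?n = "2 * m - k" and ?C = "(- 1) ^ k * fact k * real (m choose k) ^ 2"
    have "(- 1) ^ k * (fact k / real (?n + 1)) * real (m choose k) ^ 2 * pochhammer x (?n + 1) -
        (- 1) ^ k * (fact k / real (?n + 1)) * real (m choose k) ^ 2 * pochhammer (x - 1) (?n + 1) =
      ?C / real (?n + 1) * (pochhammer x (?n + 1) - pochhammer (x - 1) (?n + 1))"
      by (simp only: times_divide_eq_right times_divide_eq_left right_diff_distrib)
    also have "\<dots> = ?C * pochhammer x ?n"
      unfolding pochhammer_difference by (simp del: of_nat_Suc of_nat_add)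
    finally show "(- 1) ^ k * (fact k / real (?n + 1)) * real (m choose k) ^ 2 * pochhammer x (?n + 1) -
        (- 1) ^ k * (fact k / real (?n + 1)) * real (m choose k) ^ 2 * pochhammer (x - 1) (?n + 1) = ?C * pochhammer x ?n" .
  qed
  have zero: "(pochhammer (- real j) m)\<^sup>2 = 0" if "j < m" for j
    using pochhammer_of_nat_eq_0_lemma[OF that, where ?'a = real] by simp
  have "G (real N - real m) = - G (- real N)"
  proof (induction N)
    case 0
    have "(\<Sum>c\<in>top_slots 0 m. (pochhammer (real c + 1) m)\<^sup>2) = G (real 0) - G (real 0 - real m)"
      using step zero by (rule sum_top_slots)
    moreover have "G 0 = 0" by (simp add: G_def pochhammer_0_left)
    ultimately show ?case by (simp add: top_slots_def)
  next
    case (Suc N)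
    have "(pochhammer (real (Suc N) - real m) m)\<^sup>2 = (pochhammer (- real N) m)\<^sup>2"
      using pochhammer_minus'[of "real N" m] by (simp add: power_mult_distrib algebra_simps flip: power_mult)
    moreover have pred: "real (Suc N) - real m - 1 = real N - real m" "- real N - 1 = - real (Suc N)" by simp_all
    ultimately show ?case
      using Suc.IH step[of "real (Suc N) - real m", unfolded pred(1)] step[of "- real N", unfolded pred(2)] by linarith
  qed
  moreover have "(\<Sum>c\<in>top_slots N m. (pochhammer (real c + 1) m)\<^sup>2) = G (real N) - G (real N - real m)"
    using step zero by (rule sum_top_slots)
  ultimately have "(\<Sum>c\<in>top_slots N m. (pochhammer (real c + 1) m)\<^sup>2) = G (real N) + G (- real N)"
    by linarith
  then show ?thesis by (simp only: G_def sum.distrib distrib_left)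
qed

section \<open>The generating polynomial\<close>

lemma poly_pochhammer: "poly (pochhammer p n) x = pochhammer (poly p x) n"
  by (induction n) (simp_all add: pochhammer_Suc)

lemma poly_F_minus: "poly (F_minus n p) x = F_minus n (poly p x)"
  by (simp add: F_minus_def poly_prod)

lemma poly_eqI_nat:
  fixes p q :: "'a :: {idom, ring_char_0} poly"
  assumes "\<And>n. poly p (of_nat n) = poly q (of_nat n)"
  shows "p = q"
proof (rule ccontr)
  assume "p \<noteq> q"
  then have "finite {x. poly (p - q) x = 0}" by (intro poly_roots_finite) simp
  moreover have "range of_nat \<subseteq> {x. poly (p - q) x = 0}" using assms by auto
  ultimately have "finite (range (of_nat :: nat \<Rightarrow> 'a))" by (rule finite_subset[rotated])
  then show False using infinite_UNIV_char_0 finite_imageD inj_of_nat by blast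
qed

lemma poly_expectation_uniform_perm:
  "poly (poly_expectation (uniform_perm n) X) x = (\<Sum>\<sigma> | \<sigma> permutes {1..n}. poly (X \<sigma>) x) / fact n"
proof -
  let ?S = "{\<sigma>. \<sigma> permutes {1..n}}"
  have "id \<in> ?S" by (simp only: mem_Collect_eq permutes_id)
  then have S: "?S \<noteq> {}" "finite ?S" using finite_permutations[of "{1..n}"] by (blast, simp)
  have "card ?S = fact n" using card_permutations[of "{1..n}" n] by simp
  then show ?thesis
    using S by (simp add: poly_expectation_def uniform_perm_def poly_sum sum_divide_distrib)
qed

theorem theorem3:
  fixes M :: nat and \<tau> :: "nat \<Rightarrow> nat" and t :: "real poly"
  assumes "M \<ge> 1"
  defines "\<tau> \<equiv> two_cycles M"
    and "t \<equiv> [:0, 1:]"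
  shows "poly_expectation (uniform_perm (2 * M))
           (\<lambda>\<sigma>. t ^ num_cycles (2 * M) (commutator \<sigma> \<tau>)) =
         smult (1 / fact (2 * M + 1)) (F_plus (2 * M + 1) t - F_minus (2 * M + 1) t)
         + smult (2 / fact (2 * M))
             ((smult (1 / real (M + 1)) (F_plus (M + 1) t - F_minus (M + 1) t))\<^sup>2)
         - smult (2 / fact (2 * M))
             (\<Sum>k=0..M. smult ((-1) ^ k * (fact k / real (2 * M - k + 1)) * real (M choose k) ^ 2)
                (F_plus (2 * M - k + 1) t + F_plus (2 * M - k + 1) (- t)))"
proof (rule poly_eqI_nat)
  fix N :: nat
  let ?f = "fact (2 * M) :: real"
  have t: "poly t (real N) = real N" by (simp add: t_def)
  have cycles: "real N ^ num_cycles (2 * M) (commutator \<sigma> \<tau>) =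
      real (card (colorings N {1..2 * M} (\<sigma> \<circ> \<tau> \<circ> inv \<sigma> \<circ> inv \<tau>)))"
    if "\<sigma> permutes {1..2 * M}" for \<sigma>
  proof -
    have "\<sigma> \<circ> \<tau> \<circ> inv \<sigma> \<circ> inv \<tau> permutes {1..2 * M}"
      unfolding \<tau>_def using that two_cycles_permutes by (intro permutes_compose permutes_inv)
    then show ?thesis
      using card_colorings[of "\<sigma> \<circ> \<tau> \<circ> inv \<sigma> \<circ> inv \<tau>" "{1..2 * M}" N]
      by (simp add: num_cycles_def commutator_def)
  qed
  have expand: "(X + 2 * (Y - Z)) / ?f = 1 / ?f * X + 2 / ?f * Y - 2 / ?f * Z" for X Y Z
    by (simp add: field_simps)
  have "poly (poly_expectation (uniform_perm (2 * M)) (\<lambda>\<sigma>. t ^ num_cycles (2 * M) (commutator \<sigma> \<tau>))) (real N) =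
      conj_sum N {1..2 * M} \<tau> (inv \<tau>) / ?f"
    unfolding poly_expectation_uniform_perm conj_sum_def
    by (intro arg_cong2[where f = divide] sum.cong refl) (simp only: mem_Collect_eq poly_power t cycles)
  also have "\<dots> = 1 / ?f * (1 / real (2 * M + 1) * (F_plus (2 * M + 1) (real N) - F_minus (2 * M + 1) (real N)))
      + 2 / ?f * (1 / real (M + 1) * (F_plus (M + 1) (real N) - F_minus (M + 1) (real N)))\<^sup>2
      - 2 / ?f * (\<Sum>k=0..M. (- 1) ^ k * (fact k / real (2 * M - k + 1)) * real (M choose k) ^ 2 *
          (F_plus (2 * M - k + 1) (real N) + F_plus (2 * M - k + 1) (- real N)))"
    unfolding \<tau>_def conj_sum_two_cycles[OF assms(1)] sum_top_slots_pochhammer sum_top_slots_pochhammer_square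
    by (simp only: expand)
  also have "1 / ?f * (1 / real (2 * M + 1) * (F_plus (2 * M + 1) (real N) - F_minus (2 * M + 1) (real N))) =
      1 / fact (2 * M + 1) * (F_plus (2 * M + 1) (real N) - F_minus (2 * M + 1) (real N))"
    by (simp add: field_simps)
  finally show "poly (poly_expectation (uniform_perm (2 * M)) (\<lambda>\<sigma>. t ^ num_cycles (2 * M) (commutator \<sigma> \<tau>))) (of_nat N) =
    poly (smult (1 / fact (2 * M + 1)) (F_plus (2 * M + 1) t - F_minus (2 * M + 1) t)
         + smult (2 / fact (2 * M))
             ((smult (1 / real (M + 1)) (F_plus (M + 1) t - F_minus (M + 1) t))\<^sup>2)
         - smult (2 / fact (2 * M))
             (\<Sum>k=0..M. smult ((-1) ^ k * (fact k / real (2 * M - k + 1)) * real (M choose k) ^ 2)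
                (F_plus (2 * M - k + 1) t + F_plus (2 * M - k + 1) (- t)))) (of_nat N)"
    by (simp only: poly_add poly_diff poly_smult poly_power poly_sum poly_pochhammer poly_F_minus poly_minus t)
qed

end
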